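(* Let $g=g_0\oplus g_1$ be a $\mathbb{Z}_2$-graded complex vector space with a degree-preserving linear map $[\ ,\ ]:g\otimes g\to g$, and let $V=\mathbb{C}\oplus g$. Define the linear map $\Psi:V\otimes V\to V\otimes V$ by $$\Psi(1\otimes 1)=1\otimes 1,\quad \Psi(1\otimes\xi)=\xi\otimes 1,\quad \Psi(\xi\otimes 1)=1\otimes\xi,\quad \Psi(\xi\otimes\eta)=(-1)^{|\xi||\eta|}\eta\otimes\xi+[\xi,\eta]\otimes 1$$ for all homogeneous $\xi,\eta\in g$. Then: (i) $\Psi$ obeys the braid relation $\Psi_{23}\circ\Psi_{12}\circ\Psi_{23}=\Psi_{12}\circ\Psi_{23}\circ\Psi_{12}$ if and only if $[\ ,\ ]$ obeys the super-Jacobi identity $[\xi,[\eta,\zeta]]=[[\xi,\eta],\zeta]+(-1)^{|\xi||\eta|}[\eta,[\xi,\zeta]]$ for all homogeneous $\xi,\eta,\zeta\in g$. (ii) $\Psi$ obeys $(\Psi^2-\mathrm{id})(\Psi+\mathrm{id})=0$ if and only if $[\ ,\ ]$ is graded-antisymmetric, i.e. $[\xi,\eta]=-(-1)^{|\xi||\eta|}[\eta,\xi]$ for all homogeneous $\xi,\eta\in g$. (iii) If $g$ is a super-Lie algebra (both conditions on $[\ ,\ ]$ hold), then its super-enveloping algebra is the unital associative algebra generated by $V$, with $1\in\mathbb{C}\subset V$ identified with the unit, subject to the relations $\cdot\circ\Psi=\cdot$ on $V\otimes V$, where $\cdot$ denotes the product.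
   Context: $|\xi|\in\{0,1\}$ denotes the degree of a homogeneous element $\xi\in g$. $\Psi_{12}=\Psi\otimes\mathrm{id}$ and $\Psi_{23}=\mathrm{id}\otimes\Psi$ act on $V\otimes V\otimes V$. *)

theory Defs
  imports
    Complex_Main
    "HOL-Library.Z2"
    "HOL-Library.Poly_Mapping"
    "HOL-Library.Product_Plus"
    "HOL-Algebra.QuotRing"
    "HOL-Algebra.Algebraic_Closure_Type"
begin

class complex_vector = ab_group_add +
  fixes scaleC :: "complex \<Rightarrow> 'a \<Rightarrow> 'a" (infixr "*\<^sub>C" 75)
  assumes scaleC_right_distrib: "c *\<^sub>C (x + y) = c *\<^sub>C x + c *\<^sub>C y"
    and scaleC_left_distrib: "(c + d) *\<^sub>C x = c *\<^sub>C x + d *\<^sub>C x"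
    and scaleC_scaleC: "c *\<^sub>C d *\<^sub>C x = (c * d) *\<^sub>C x"
    and scaleC_one: "1 *\<^sub>C x = x"

global_interpretation complex_vector:
  vector_space "scaleC :: complex \<Rightarrow> 'a \<Rightarrow> 'a::complex_vector"
  by standard (simp_all add: scaleC_right_distrib scaleC_left_distrib scaleC_scaleC scaleC_one)

abbreviation clinear :: "('a::complex_vector \<Rightarrow> 'b::complex_vector) \<Rightarrow> bool"
  where "clinear \<equiv> Vector_Spaces.linear scaleC scaleC"

definition cbilinear :: "('a::complex_vector \<Rightarrow> 'b::complex_vector \<Rightarrow> 'c::complex_vector) \<Rightarrow> bool"
  where "cbilinear f \<longleftrightarrow> (\<forall>x. clinear (f x)) \<and> (\<forall>y. clinear (\<lambda>x. f x y))"

lemma clinear_iff: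
  "clinear f \<longleftrightarrow> (\<forall>x y. f (x + y) = f x + f y) \<and> (\<forall>c x. f (c *\<^sub>C x) = c *\<^sub>C f x)"
  by (simp add: Vector_Spaces.linear_iff complex_vector.vector_space_axioms)

lemma clinearI:
  "(\<And>x y. f (x + y) = f x + f y) \<Longrightarrow> (\<And>c x. f (c *\<^sub>C x) = c *\<^sub>C f x) \<Longrightarrow> clinear f"
  by (simp add: clinear_iff)

lemma clinear_add: "clinear f \<Longrightarrow> f (x + y) = f x + f y"
  and clinear_scaleC: "clinear f \<Longrightarrow> f (c *\<^sub>C x) = c *\<^sub>C f x"
  by (auto simp: clinear_iff)

lemma clinear_zero: "clinear f \<Longrightarrow> f 0 = 0"
  using clinear_add[of f 0 0] by simp

lemma clinear_minus: "clinear f \<Longrightarrow> f (x - y) = f x - f y"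
  using clinear_add[of f "x - y" y] by (simp add: algebra_simps)

lemma clinear_compose: "clinear f \<Longrightarrow> clinear g \<Longrightarrow> clinear (\<lambda>x. g (f x))"
  by (simp add: clinear_iff)

instantiation complex :: complex_vector
begin
definition scaleC_complex :: "complex \<Rightarrow> complex \<Rightarrow> complex"
  where "scaleC_complex c x = c * x"
instance by standard (simp_all add: scaleC_complex_def algebra_simps)
end

instantiation prod :: (complex_vector, complex_vector) complex_vector
begin
definition scaleC_prod :: "complex \<Rightarrow> 'a \<times> 'b \<Rightarrow> 'a \<times> 'b"
  where "scaleC_prod c x = (c *\<^sub>C fst x, c *\<^sub>C snd x)"
instance
  by standard (simp_all add: scaleC_prod_def prod_eq_iff scaleC_right_distrib scaleC_left_distrib
      scaleC_scaleC scaleC_one)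
end

instantiation poly_mapping :: (type, complex_vector) complex_vector
begin
definition scaleC_poly_mapping :: "complex \<Rightarrow> ('a \<Rightarrow>\<^sub>0 'b) \<Rightarrow> ('a \<Rightarrow>\<^sub>0 'b)"
  where "scaleC_poly_mapping c = Poly_Mapping.map (scaleC c)"

lemma lookup_scaleC:
  "Poly_Mapping.lookup (c *\<^sub>C p) k = c *\<^sub>C Poly_Mapping.lookup p k"
  by (simp add: scaleC_poly_mapping_def Poly_Mapping.map.rep_eq when_def)

instance
  by standard (auto intro!: poly_mapping_eqI simp: lookup_scaleC lookup_add scaleC_right_distrib
      scaleC_left_distrib scaleC_scaleC scaleC_one)
end

lemma scaleC_single: "c *\<^sub>C Poly_Mapping.single k d = Poly_Mapping.single k (c *\<^sub>C d)"
  by (rule poly_mapping_eqI) (simp add: lookup_scaleC lookup_single when_def)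

lemma poly_mapping_add_induct [case_names zero single add]:
  assumes "P 0" "\<And>k c. P (Poly_Mapping.single k c)" "\<And>p q. P p \<Longrightarrow> P q \<Longrightarrow> P (p + q)"
  shows "P (p :: 'a \<Rightarrow>\<^sub>0 'b::monoid_add)"
proof (induction p rule: update_induct)
  case const
  show ?case by (rule assms(1))
next
  case (update f a b)
  have "Poly_Mapping.update a b f = f + Poly_Mapping.single a b"
    using update(1) by (intro poly_mapping_eqI)
      (auto simp: lookup_update lookup_add lookup_single when_def in_keys_iff)
  with update assms show ?case by simp
qed

text \<open>\<open>'a \<Rightarrow>\<^sub>0 complex\<close> serves as the free complex vector space on the elements of \<open>'a\<close>.\<close>

definition free_ext :: "('a \<Rightarrow> 'b::complex_vector) \<Rightarrow> ('a \<Rightarrow>\<^sub>0 complex) \<Rightarrow> 'b"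
  where "free_ext f p = (\<Sum>k\<in>Poly_Mapping.keys p. Poly_Mapping.lookup p k *\<^sub>C f k)"

lemma free_ext_superset:
  assumes "finite A" "Poly_Mapping.keys p \<subseteq> A"
  shows "free_ext f p = (\<Sum>k\<in>A. Poly_Mapping.lookup p k *\<^sub>C f k)"
  unfolding free_ext_def using assms
  by (intro sum.mono_neutral_left) (auto simp: in_keys_iff)

lemma clinear_free_ext: "clinear (free_ext f)"
proof (rule clinearI)
  fix p q :: "'a \<Rightarrow>\<^sub>0 complex"
  let ?A = "Poly_Mapping.keys p \<union> Poly_Mapping.keys q"
  have "Poly_Mapping.keys (p + q) \<subseteq> ?A" by (rule Poly_Mapping.keys_add)
  then show "free_ext f (p + q) = free_ext f p + free_ext f q"
    by (simp add: free_ext_superset[of ?A] lookup_add scaleC_left_distrib sum.distrib)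
next
  fix c and p :: "'a \<Rightarrow>\<^sub>0 complex"
  let ?A = "Poly_Mapping.keys p"
  have "Poly_Mapping.keys (c *\<^sub>C p) \<subseteq> ?A"
    by (auto simp: in_keys_iff lookup_scaleC)
  then show "free_ext f (c *\<^sub>C p) = c *\<^sub>C free_ext f p"
    by (simp add: free_ext_superset[of ?A] lookup_scaleC complex_vector.scale_sum_right
        scaleC_complex_def)
qed

lemma free_ext_single [simp]: "free_ext f (Poly_Mapping.single k c) = c *\<^sub>C f k"
  by (simp add: free_ext_superset[of "{k}"])

lemma clinear_eq_on_free:
  assumes "clinear f" "clinear g"
    and "\<And>k. f (Poly_Mapping.single k 1) = g (Poly_Mapping.single k 1)"
  shows "f p = g (p :: 'a \<Rightarrow>\<^sub>0 complex)"
proof (induction p rule: poly_mapping_add_induct)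
  case zero
  show ?case using assms by (simp add: clinear_zero)
next
  case (single k c)
  have "Poly_Mapping.single k c = c *\<^sub>C Poly_Mapping.single k 1"
    by (simp add: scaleC_single scaleC_complex_def)
  then show ?case using assms by (simp add: clinear_scaleC)
next
  case (add p q)
  then show ?case using assms by (simp add: clinear_add)
qed

definition tensor_relators :: "('a::complex_vector \<times> 'b::complex_vector \<Rightarrow>\<^sub>0 complex) set"
  where "tensor_relators =
     {Poly_Mapping.single (x + x', y) 1 - Poly_Mapping.single (x, y) 1
        - Poly_Mapping.single (x', y) 1 | x x' y. True}
   \<union> {Poly_Mapping.single (x, y + y') 1 - Poly_Mapping.single (x, y) 1
        - Poly_Mapping.single (x, y') 1 | x y y'. True}
   \<union> {Poly_Mapping.single (c *\<^sub>C x, y) 1 - Poly_Mapping.single (x, y) c | c x y. True}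
   \<union> {Poly_Mapping.single (x, c *\<^sub>C y) 1 - Poly_Mapping.single (x, y) c | c x y. True}"

definition tensor_rel ::
  "('a::complex_vector \<times> 'b::complex_vector \<Rightarrow>\<^sub>0 complex) \<Rightarrow> ('a \<times> 'b \<Rightarrow>\<^sub>0 complex) \<Rightarrow> bool"
  where "tensor_rel p q \<longleftrightarrow> p - q \<in> complex_vector.span tensor_relators"

lemma span_equivp:
  "equivp (\<lambda>p q. p - q \<in> complex_vector.span S)"
proof (rule equivpI)
  show "reflp (\<lambda>p q. p - q \<in> complex_vector.span S)"
    by (auto intro!: reflpI complex_vector.span_zero)
  show "symp (\<lambda>p q. p - q \<in> complex_vector.span S)"
    by (rule sympI) (metis complex_vector.span_neg minus_diff_eq)
  show "transp (\<lambda>p q. p - q \<in> complex_vector.span S)"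
    by (rule transpI) (metis complex_vector.span_add diff_add_cancel add_diff_eq)
qed

quotient_type (overloaded) ('a, 'b) tensor =
  "('a::complex_vector \<times> 'b::complex_vector) \<Rightarrow>\<^sub>0 complex" / tensor_rel
  unfolding tensor_rel_def by (rule span_equivp)

instantiation tensor :: (complex_vector, complex_vector) complex_vector
begin

lift_definition zero_tensor :: "('a, 'b) tensor" is 0 .
lift_definition plus_tensor :: "('a, 'b) tensor \<Rightarrow> ('a, 'b) tensor \<Rightarrow> ('a, 'b) tensor" is "(+)"
  unfolding tensor_rel_def by (metis complex_vector.span_add add_diff_add)
lift_definition minus_tensor :: "('a, 'b) tensor \<Rightarrow> ('a, 'b) tensor \<Rightarrow> ('a, 'b) tensor" is "(-)"
proof -
  fix a b c d :: "('a \<times> 'b) \<Rightarrow>\<^sub>0 complex"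
  assume "tensor_rel a b" "tensor_rel c d"
  moreover have "(a - c) - (b - d) = (a - b) - (c - d)" by simp
  ultimately show "tensor_rel (a - c) (b - d)"
    unfolding tensor_rel_def by (metis complex_vector.span_diff)
qed
lift_definition uminus_tensor :: "('a, 'b) tensor \<Rightarrow> ('a, 'b) tensor" is "uminus"
  unfolding tensor_rel_def by (metis complex_vector.span_neg minus_diff_minus)
lift_definition scaleC_tensor :: "complex \<Rightarrow> ('a, 'b) tensor \<Rightarrow> ('a, 'b) tensor" is scaleC
  unfolding tensor_rel_def by (metis complex_vector.span_scale complex_vector.scale_right_diff_distrib)

lemma tensor_rel_refl: "tensor_rel p p"
  by (simp add: tensor_rel_def complex_vector.span_zero)

instance
  by standard (transfer; simp add: tensor_rel_refl algebra_simps scaleC_right_distrib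
      scaleC_left_distrib scaleC_scaleC scaleC_one)+

end

lift_definition tens :: "'a::complex_vector \<Rightarrow> 'b::complex_vector \<Rightarrow> ('a, 'b) tensor"
    (infixr "\<otimes>\<^sub>t" 72)
  is "\<lambda>x y. Poly_Mapping.single (x, y) 1" .

lemma tensor_rel_base: "p - q \<in> tensor_relators \<Longrightarrow> tensor_rel p q"
  unfolding tensor_rel_def by (rule complex_vector.span_base)

lemma tens_add_right: "x \<otimes>\<^sub>t (y + y') = x \<otimes>\<^sub>t y + x \<otimes>\<^sub>t y'"
  by transfer (rule tensor_rel_base, unfold tensor_relators_def diff_diff_eq[symmetric], blast)

lemma tens_add_left: "(x + x') \<otimes>\<^sub>t y = x \<otimes>\<^sub>t y + x' \<otimes>\<^sub>t y"
  by transfer (rule tensor_rel_base, unfold tensor_relators_def diff_diff_eq[symmetric], blast)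

lemma tens_scaleC_right: "x \<otimes>\<^sub>t (c *\<^sub>C y) = c *\<^sub>C (x \<otimes>\<^sub>t y)"
  by transfer (rule tensor_rel_base,
      unfold tensor_relators_def scaleC_single scaleC_complex_def mult_1_right, blast)

lemma tens_scaleC_left: "(c *\<^sub>C x) \<otimes>\<^sub>t y = c *\<^sub>C (x \<otimes>\<^sub>t y)"
  by transfer (rule tensor_rel_base,
      unfold tensor_relators_def scaleC_single scaleC_complex_def mult_1_right, blast)

lemmas tens_lin = tens_add_left tens_add_right tens_scaleC_left tens_scaleC_right

lemma cbilinear_tens: "cbilinear (\<otimes>\<^sub>t)"
  by (simp add: cbilinear_def clinear_iff tens_lin)

lemma tensor_ext:
  assumes f: "clinear f" and g: "clinear g" and eq: "\<And>x y. f (x \<otimes>\<^sub>t y) = g (x \<otimes>\<^sub>t y)"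
  shows "f = g"
proof
  fix t
  have lin: "clinear abs_tensor"
    by (rule clinearI) (simp_all add: plus_tensor.abs_eq scaleC_tensor.abs_eq)
  have "f (abs_tensor p) = g (abs_tensor p)" for p
  proof (rule clinear_eq_on_free[of "\<lambda>p. f (abs_tensor p)" "\<lambda>p. g (abs_tensor p)"])
    show "clinear (\<lambda>p. f (abs_tensor p))" "clinear (\<lambda>p. g (abs_tensor p))"
      using clinear_compose[OF lin] f g by auto
    show "f (abs_tensor (Poly_Mapping.single k 1)) = g (abs_tensor (Poly_Mapping.single k 1))"
      for k
      using eq[of "fst k" "snd k"] by (simp add: tens.abs_eq)
  qed
  then show "f t = g t" by (metis Quotient_abs_rep[OF Quotient_tensor])
qed

definition tensor_lift ::
    "('a::complex_vector \<Rightarrow> 'b::complex_vector \<Rightarrow> 'c::complex_vector) \<Rightarrow> ('a, 'b) tensor \<Rightarrow> 'c"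
  where "tensor_lift f = (THE h. clinear h \<and> (\<forall>x y. h (x \<otimes>\<^sub>t y) = f x y))"

lemma tensor_universal:
  assumes f: "cbilinear f"
  shows "\<exists>!h. clinear h \<and> (\<forall>x y. h (x \<otimes>\<^sub>t y) = f x y)"
proof (rule ex_ex1I)
  define F where "F = free_ext (\<lambda>(x, y). f x y)"
  have F: "clinear F" unfolding F_def by (rule clinear_free_ext)
  have ker: "F p = 0" if "p \<in> complex_vector.span tensor_relators" for p
    using that
  proof (induction rule: complex_vector.span_induct_alt)
    case base
    show ?case using F by (rule clinear_zero)
  next
    case (step c x y)
    have "F x = 0"
      using step(1) f unfolding tensor_relators_def cbilinear_def clinear_iff
      by (auto simp: clinear_minus[OF F]) (auto simp: F_def scaleC_one)
    with step show ?case by (simp add: clinear_add[OF F] clinear_scaleC[OF F])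
  qed
  define h where "h t = F (rep_tensor t)" for t
  have h: "h (abs_tensor p) = F p" for p
  proof -
    have "tensor_rel (rep_tensor (abs_tensor p)) p"
      by (metis Quotient_tensor Quotient_rep_abs tensor_rel_refl)
    then have "F (rep_tensor (abs_tensor p) - p) = 0"
      unfolding tensor_rel_def by (rule ker)
    then show ?thesis by (simp add: h_def clinear_minus[OF F])
  qed
  have ab: "\<exists>p. t = abs_tensor p" for t :: "('a, 'b) tensor"
    by (metis Quotient_abs_rep[OF Quotient_tensor])
  have "clinear h"
  proof (rule clinearI)
    fix s t :: "('a, 'b) tensor"
    obtain p q where "s = abs_tensor p" "t = abs_tensor q" using ab by blast
    then show "h (s + t) = h s + h t"
      by (simp add: plus_tensor.abs_eq h clinear_add[OF F])
  next
    fix c and t :: "('a, 'b) tensor"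
    obtain p where "t = abs_tensor p" using ab by blast
    then show "h (c *\<^sub>C t) = c *\<^sub>C h t"
      by (simp add: scaleC_tensor.abs_eq h clinear_scaleC[OF F])
  qed
  moreover have "h (x \<otimes>\<^sub>t y) = f x y" for x y
    by (simp add: tens.abs_eq h) (simp add: F_def scaleC_one)
  ultimately show "\<exists>h. clinear h \<and> (\<forall>x y. h (x \<otimes>\<^sub>t y) = f x y)" by blast
next
  fix h k
  assume "clinear h \<and> (\<forall>x y. h (x \<otimes>\<^sub>t y) = f x y)"
    "clinear k \<and> (\<forall>x y. k (x \<otimes>\<^sub>t y) = f x y)"
  then show "h = k" by (intro tensor_ext) auto
qed

lemma
  assumes "cbilinear f"
  shows clinear_tensor_lift: "clinear (tensor_lift f)"
    and tensor_lift_tens [simp]: "tensor_lift f (x \<otimes>\<^sub>t y) = f x y"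
  using theI'[OF tensor_universal[OF assms]] unfolding tensor_lift_def by auto

definition tensor_map :: "('a::complex_vector \<Rightarrow> 'c::complex_vector)
    \<Rightarrow> ('b::complex_vector \<Rightarrow> 'd::complex_vector) \<Rightarrow> ('a, 'b) tensor \<Rightarrow> ('c, 'd) tensor"
  where "tensor_map f g = tensor_lift (\<lambda>x y. f x \<otimes>\<^sub>t g y)"

lemma cbilinear_tensor_map: "clinear f \<Longrightarrow> clinear g \<Longrightarrow> cbilinear (\<lambda>x y. f x \<otimes>\<^sub>t g y)"
  by (simp add: cbilinear_def clinear_iff tens_lin)

lemma
  assumes "clinear f" "clinear g"
  shows clinear_tensor_map: "clinear (tensor_map f g)"
    and tensor_map_tens: "tensor_map f g (x \<otimes>\<^sub>t y) = f x \<otimes>\<^sub>t g y"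
  unfolding tensor_map_def
  using clinear_tensor_lift[OF cbilinear_tensor_map] tensor_lift_tens[OF cbilinear_tensor_map] assms
  by auto

definition tensor_assoc :: "(('a::complex_vector, 'b::complex_vector) tensor, 'c::complex_vector) tensor
    \<Rightarrow> ('a, ('b, 'c) tensor) tensor"
  where "tensor_assoc = tensor_lift (\<lambda>t z. tensor_lift (\<lambda>x y. x \<otimes>\<^sub>t (y \<otimes>\<^sub>t z)) t)"

definition tensor_unassoc :: "('a::complex_vector, ('b::complex_vector, 'c::complex_vector) tensor) tensor
    \<Rightarrow> (('a, 'b) tensor, 'c) tensor"
  where "tensor_unassoc = tensor_lift (\<lambda>x. tensor_lift (\<lambda>y z. (x \<otimes>\<^sub>t y) \<otimes>\<^sub>t z))"

lemma
  fixes x :: "'a::complex_vector" and y :: "'b::complex_vector" and z :: "'c::complex_vector"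
  shows clinear_tensor_assoc: "clinear (tensor_assoc :: (('a, 'b) tensor, 'c) tensor \<Rightarrow> _)"
    and tensor_assoc_tens [simp]: "tensor_assoc ((x \<otimes>\<^sub>t y) \<otimes>\<^sub>t z) = x \<otimes>\<^sub>t (y \<otimes>\<^sub>t z)"
proof -
  let ?f = "\<lambda>z x y. (x :: 'a) \<otimes>\<^sub>t ((y :: 'b) \<otimes>\<^sub>t (z :: 'c))"
  have bil: "cbilinear (?f z)" for z
    by (simp add: cbilinear_def clinear_iff tens_lin)
  note L = clinear_tensor_lift[OF bil]
  have T: "tensor_lift (?f u) (v \<otimes>\<^sub>t w) = ?f u v w" for u v w
    by (rule tensor_lift_tens[OF bil])
  have 1: "tensor_lift (?f (z + z')) = (\<lambda>t. tensor_lift (?f z) t + tensor_lift (?f z') t)" for z z'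
    by (rule tensor_ext[OF L], rule clinearI)
      (simp_all only: clinear_add[OF L] clinear_scaleC[OF L] scaleC_right_distrib T ac_simps,
        simp only: tens_lin ac_simps)
  have 2: "tensor_lift (?f (c *\<^sub>C z)) = (\<lambda>t. c *\<^sub>C tensor_lift (?f z) t)" for c z
    by (rule tensor_ext[OF L], rule clinearI)
      (simp_all only: clinear_add[OF L] clinear_scaleC[OF L] scaleC_right_distrib T
        scaleC_scaleC ac_simps, simp only: tens_lin)
  have "cbilinear (\<lambda>t z. tensor_lift (?f z) t)"
    unfolding cbilinear_def using L by (auto intro!: clinearI simp: 1 2)
  then show "clinear (tensor_assoc :: (('a, 'b) tensor, 'c) tensor \<Rightarrow> _)"
    "tensor_assoc ((x \<otimes>\<^sub>t y) \<otimes>\<^sub>t z) = x \<otimes>\<^sub>t (y \<otimes>\<^sub>t z)"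
    unfolding tensor_assoc_def
    by (simp_all add: clinear_tensor_lift tensor_lift_tens[OF bil])
qed

lemma
  fixes x :: "'a::complex_vector" and y :: "'b::complex_vector" and z :: "'c::complex_vector"
  shows clinear_tensor_unassoc: "clinear (tensor_unassoc :: ('a, ('b, 'c) tensor) tensor \<Rightarrow> _)"
    and tensor_unassoc_tens [simp]: "tensor_unassoc (x \<otimes>\<^sub>t (y \<otimes>\<^sub>t z)) = (x \<otimes>\<^sub>t y) \<otimes>\<^sub>t z"
proof -
  let ?f = "\<lambda>x y z. ((x :: 'a) \<otimes>\<^sub>t (y :: 'b)) \<otimes>\<^sub>t (z :: 'c)"
  have bil: "cbilinear (?f x)" for x
    by (simp add: cbilinear_def clinear_iff tens_lin)
  note L = clinear_tensor_lift[OF bil]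
  have T: "tensor_lift (?f u) (v \<otimes>\<^sub>t w) = ?f u v w" for u v w
    by (rule tensor_lift_tens[OF bil])
  have 1: "tensor_lift (?f (z + z')) = (\<lambda>t. tensor_lift (?f z) t + tensor_lift (?f z') t)" for z z'
    by (rule tensor_ext[OF L], rule clinearI)
      (simp_all only: clinear_add[OF L] clinear_scaleC[OF L] scaleC_right_distrib T ac_simps,
        simp only: tens_lin ac_simps)
  have 2: "tensor_lift (?f (c *\<^sub>C z)) = (\<lambda>t. c *\<^sub>C tensor_lift (?f z) t)" for c z
    by (rule tensor_ext[OF L], rule clinearI)
      (simp_all only: clinear_add[OF L] clinear_scaleC[OF L] scaleC_right_distrib T
        scaleC_scaleC ac_simps, simp only: tens_lin)
  have "cbilinear (\<lambda>x. tensor_lift (?f x))"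
    unfolding cbilinear_def using L by (auto intro!: clinearI simp: 1 2)
  then show "clinear (tensor_unassoc :: ('a, ('b, 'c) tensor) tensor \<Rightarrow> _)"
    "tensor_unassoc (x \<otimes>\<^sub>t (y \<otimes>\<^sub>t z)) = (x \<otimes>\<^sub>t y) \<otimes>\<^sub>t z"
    unfolding tensor_unassoc_def
    by (simp_all add: clinear_tensor_lift tensor_lift_tens[OF bil])
qed

text \<open>Words over \<open>'v\<close> under concatenation; \<open>'v list \<Rightarrow>\<^sub>0 complex\<close> with the convolution product is then the free unital associative algebra on the set \<open>'v\<close>.\<close>

instantiation list :: (type) monoid_add
begin
definition zero_list :: "'a list" where "zero_list = []"
definition plus_list :: "'a list \<Rightarrow> 'a list \<Rightarrow> 'a list" where "plus_list = (@)"
instance by standard (simp_all add: zero_list_def plus_list_def)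
end

text \<open>Imposing multilinearity on words of each length yields the direct sum of all the tensor
  powers of \<open>'v\<close>.\<close>

definition talg_relators :: "('v::complex_vector list \<Rightarrow>\<^sub>0 complex) set"
  where "talg_relators =
     {Poly_Mapping.single (u @ [x + y] @ w) 1 - Poly_Mapping.single (u @ [x] @ w) 1
        - Poly_Mapping.single (u @ [y] @ w) 1 | u x y w. True}
   \<union> {Poly_Mapping.single (u @ [c *\<^sub>C x] @ w) 1 - Poly_Mapping.single (u @ [x] @ w) c
        | c u x w. True}"

definition talg_rel ::
  "('v::complex_vector list \<Rightarrow>\<^sub>0 complex) \<Rightarrow> ('v list \<Rightarrow>\<^sub>0 complex) \<Rightarrow> bool"
  where "talg_rel p q \<longleftrightarrow> p - q \<in> complex_vector.span talg_relators"

quotient_type (overloaded) 'v tensor_algebra = "'v::complex_vector list \<Rightarrow>\<^sub>0 complex" / talg_rel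
  unfolding talg_rel_def by (rule span_equivp)

lemma talg_rel_refl: "talg_rel p p"
  by (simp add: talg_rel_def complex_vector.span_zero)

lemma scaleC_mult_free:
  fixes p q :: "'v list \<Rightarrow>\<^sub>0 complex"
  shows "c *\<^sub>C p = Poly_Mapping.single [] c * p" "c *\<^sub>C p = p * Poly_Mapping.single [] c"
proof -
  show "c *\<^sub>C p = Poly_Mapping.single [] c * p"
    by (induction p rule: poly_mapping_add_induct)
      (simp_all add: scaleC_right_distrib scaleC_single scaleC_complex_def mult_single plus_list_def
        algebra_simps)
  show "c *\<^sub>C p = p * Poly_Mapping.single [] c"
    by (induction p rule: poly_mapping_add_induct)
      (simp_all add: scaleC_right_distrib scaleC_single scaleC_complex_def mult_single plus_list_def
        algebra_simps)
qed

lemma scaleC_mult_left: "(c *\<^sub>C p) * q = c *\<^sub>C (p * q)" for p q :: "'v list \<Rightarrow>\<^sub>0 complex"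
  by (simp only: scaleC_mult_free(1) mult.assoc)

lemma scaleC_mult_right: "p * (c *\<^sub>C q) = c *\<^sub>C (p * q)" for p q :: "'v list \<Rightarrow>\<^sub>0 complex"
  by (simp only: scaleC_mult_free(2) mult.assoc)

lemma talg_relators_mult_single:
  assumes "r \<in> talg_relators"
  shows "Poly_Mapping.single v 1 * r \<in> talg_relators" "r * Poly_Mapping.single v 1 \<in> talg_relators"
proof -
  consider u x y w where "r = Poly_Mapping.single (u @ [x + y] @ w) 1
      - Poly_Mapping.single (u @ [x] @ w) 1 - Poly_Mapping.single (u @ [y] @ w) 1"
    | c u x w where "r = Poly_Mapping.single (u @ [c *\<^sub>C x] @ w) 1 - Poly_Mapping.single (u @ [x] @ w) c"
    using assms unfolding talg_relators_def by blast
  then have "Poly_Mapping.single v 1 * r \<in> talg_relators \<and> r * Poly_Mapping.single v 1 \<in> talg_relators"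
  proof cases
    case (1 u x y w)
    have "Poly_Mapping.single v 1 * r = Poly_Mapping.single ((v @ u) @ [x + y] @ w) 1
      - Poly_Mapping.single ((v @ u) @ [x] @ w) 1 - Poly_Mapping.single ((v @ u) @ [y] @ w) 1"
      "r * Poly_Mapping.single v 1 = Poly_Mapping.single (u @ [x + y] @ (w @ v)) 1
      - Poly_Mapping.single (u @ [x] @ (w @ v)) 1 - Poly_Mapping.single (u @ [y] @ (w @ v)) 1"
      by (simp_all add: 1 mult_single plus_list_def right_diff_distrib left_diff_distrib)
    then show ?thesis unfolding talg_relators_def by blast
  next
    case (2 c u x w)
    have "Poly_Mapping.single v 1 * r = Poly_Mapping.single ((v @ u) @ [c *\<^sub>C x] @ w) 1
      - Poly_Mapping.single ((v @ u) @ [x] @ w) c"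
      "r * Poly_Mapping.single v 1 = Poly_Mapping.single (u @ [c *\<^sub>C x] @ (w @ v)) 1
      - Poly_Mapping.single (u @ [x] @ (w @ v)) c"
      by (simp_all add: 2 mult_single plus_list_def right_diff_distrib left_diff_distrib)
    then show ?thesis unfolding talg_relators_def by blast
  qed
  then show "Poly_Mapping.single v 1 * r \<in> talg_relators" "r * Poly_Mapping.single v 1 \<in> talg_relators"
    by auto
qed

lemma talg_span_mult:
  assumes "r \<in> complex_vector.span talg_relators"
  shows "p * r \<in> complex_vector.span talg_relators" "r * p \<in> complex_vector.span talg_relators"
proof -
  let ?S = "complex_vector.span talg_relators"
  have s: "Poly_Mapping.single v 1 * r \<in> ?S \<and> r * Poly_Mapping.single v 1 \<in> ?S" for v
    using assms
  proof (induction rule: complex_vector.span_induct_alt)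
    case base
    show ?case by (simp add: complex_vector.span_zero)
  next
    case (step c x y)
    then show ?case
      by (simp add: distrib_left distrib_right scaleC_mult_left scaleC_mult_right
          complex_vector.span_add complex_vector.span_scale complex_vector.span_base
          talg_relators_mult_single)
  qed
  have "p * r \<in> ?S \<and> r * p \<in> ?S"
  proof (induction p rule: poly_mapping_add_induct)
    case zero
    show ?case by (simp add: complex_vector.span_zero)
  next
    case (single v c)
    have "Poly_Mapping.single v c = c *\<^sub>C Poly_Mapping.single v 1"
      by (simp add: scaleC_single scaleC_complex_def)
    with s show ?case
      by (auto simp: scaleC_mult_left scaleC_mult_right intro!: complex_vector.span_scale)
  next
    case (add p q)
    then show ?case by (auto simp: distrib_left distrib_right intro!: complex_vector.span_add)
  qed
  then show "p * r \<in> ?S" "r * p \<in> ?S" by auto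
qed

instantiation tensor_algebra :: (complex_vector) complex_vector
begin

lift_definition zero_tensor_algebra :: "'a tensor_algebra" is 0 .
lift_definition plus_tensor_algebra :: "'a tensor_algebra \<Rightarrow> 'a tensor_algebra \<Rightarrow> 'a tensor_algebra" is "(+)"
  unfolding talg_rel_def by (metis complex_vector.span_add add_diff_add)
lift_definition minus_tensor_algebra :: "'a tensor_algebra \<Rightarrow> 'a tensor_algebra \<Rightarrow> 'a tensor_algebra" is "(-)"
proof -
  fix a b c d :: "'a list \<Rightarrow>\<^sub>0 complex"
  assume "talg_rel a b" "talg_rel c d"
  moreover have "(a - c) - (b - d) = (a - b) - (c - d)" by simp
  ultimately show "talg_rel (a - c) (b - d)"
    unfolding talg_rel_def by (metis complex_vector.span_diff)
qed
lift_definition uminus_tensor_algebra :: "'a tensor_algebra \<Rightarrow> 'a tensor_algebra" is "uminus"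
  unfolding talg_rel_def by (metis complex_vector.span_neg minus_diff_minus)
lift_definition scaleC_tensor_algebra :: "complex \<Rightarrow> 'a tensor_algebra \<Rightarrow> 'a tensor_algebra" is scaleC
  unfolding talg_rel_def by (metis complex_vector.span_scale complex_vector.scale_right_diff_distrib)

instance
  by standard (transfer; simp add: talg_rel_refl algebra_simps scaleC_right_distrib
      scaleC_left_distrib scaleC_scaleC scaleC_one)+

end

lemma talg_one_neq_zero: "\<not> talg_rel 1 0"
proof
  assume "talg_rel (1 :: 'v::complex_vector list \<Rightarrow>\<^sub>0 complex) 0"
  then have "(1 :: 'v list \<Rightarrow>\<^sub>0 complex) \<in> complex_vector.span talg_relators"
    by (simp add: talg_rel_def)
  moreover have "Poly_Mapping.lookup p [] = 0" if "p \<in> complex_vector.span talg_relators"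
    for p :: "'v list \<Rightarrow>\<^sub>0 complex"
    using that
  proof (induction rule: complex_vector.span_induct_alt)
    case base
    show ?case by simp
  next
    case (step c x y)
    have "Poly_Mapping.lookup x [] = 0"
      using step(1) by (auto simp: talg_relators_def lookup_minus lookup_single when_def)
    with step show ?case by (simp add: lookup_add lookup_scaleC)
  qed
  ultimately have "Poly_Mapping.lookup (1 :: 'v list \<Rightarrow>\<^sub>0 complex) [] = 0" by blast
  then show False by (simp add: lookup_one zero_list_def)
qed

instantiation tensor_algebra :: (complex_vector) ring_1
begin

lift_definition one_tensor_algebra :: "'a tensor_algebra" is 1 .
lift_definition times_tensor_algebra :: "'a tensor_algebra \<Rightarrow> 'a tensor_algebra \<Rightarrow> 'a tensor_algebra" is "(*)"
proof -
  fix a b c d :: "'a list \<Rightarrow>\<^sub>0 complex"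
  assume "talg_rel a b" "talg_rel c d"
  moreover have "a * c - b * d = a * (c - d) + (a - b) * d" by (simp add: algebra_simps)
  ultimately show "talg_rel (a * c) (b * d)"
    unfolding talg_rel_def by (simp add: talg_span_mult complex_vector.span_add)
qed

instance
proof
  fix a b c :: "'a tensor_algebra"
  show "a * b * c = a * (b * c)"
    by transfer (simp add: mult.assoc talg_rel_refl)
  show "1 * a = a" "a * 1 = a"
    by (transfer; simp add: talg_rel_refl)+
  show "(a + b) * c = a * c + b * c" "a * (b + c) = a * b + a * c"
    by (transfer; simp add: distrib_left distrib_right talg_rel_refl)+
  show "(0 :: 'a tensor_algebra) \<noteq> 1"
    using talg_one_neq_zero unfolding zero_tensor_algebra_def one_tensor_algebra_def
    by (metis map_fun_apply id_apply tensor_algebra.abs_eq_iff)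
qed

end

lift_definition talg_inj :: "'v::complex_vector \<Rightarrow> 'v tensor_algebra"
  is "\<lambda>x. Poly_Mapping.single [x] 1" .

lemma talg_scaleC_mult: "(c *\<^sub>C p) * q = c *\<^sub>C (p * q)" "p * (c *\<^sub>C q) = c *\<^sub>C (p * q)"
  for p q :: "'v::complex_vector tensor_algebra"
  by (transfer; simp add: talg_rel_refl scaleC_mult_left scaleC_mult_right)+

lemma clinear_talg_inj: "clinear talg_inj"
proof (rule clinearI)
  fix x y :: 'a
  have "Poly_Mapping.single [x + y] (1::complex)
      - (Poly_Mapping.single [x] 1 + Poly_Mapping.single [y] 1)
    = Poly_Mapping.single ([] @ [x + y] @ []) 1
      - Poly_Mapping.single ([] @ [x] @ []) 1 - Poly_Mapping.single ([] @ [y] @ []) 1"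
    by simp
  also have "\<dots> \<in> talg_relators"
    unfolding talg_relators_def by blast
  finally have "talg_rel (Poly_Mapping.single [x + y] 1)
      (Poly_Mapping.single [x] 1 + Poly_Mapping.single [y] 1)"
    unfolding talg_rel_def by (rule complex_vector.span_base)
  then show "talg_inj (x + y) = talg_inj x + talg_inj y"
    by (simp add: talg_inj.abs_eq plus_tensor_algebra.abs_eq tensor_algebra.abs_eq_iff)
next
  fix c and x :: 'a
  have "Poly_Mapping.single [c *\<^sub>C x] (1::complex) - c *\<^sub>C Poly_Mapping.single [x] 1
    = Poly_Mapping.single ([] @ [c *\<^sub>C x] @ []) 1 - Poly_Mapping.single ([] @ [x] @ []) c"
    by (simp add: scaleC_single scaleC_complex_def)
  also have "\<dots> \<in> talg_relators"
    unfolding talg_relators_def by blast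
  finally have "talg_rel (Poly_Mapping.single [c *\<^sub>C x] 1) (c *\<^sub>C Poly_Mapping.single [x] 1)"
    unfolding talg_rel_def by (rule complex_vector.span_base)
  then show "talg_inj (c *\<^sub>C x) = c *\<^sub>C talg_inj x"
    by (simp add: talg_inj.abs_eq scaleC_tensor_algebra.abs_eq tensor_algebra.abs_eq_iff)
qed

definition talg_mult :: "('v::complex_vector, 'v) tensor \<Rightarrow> 'v tensor_algebra"
  where "talg_mult = tensor_lift (\<lambda>x y. talg_inj x * talg_inj y)"

lemma
  fixes x y :: "'v::complex_vector"
  shows clinear_talg_mult: "clinear (talg_mult :: ('v, 'v) tensor \<Rightarrow> _)"
    and talg_mult_tens [simp]: "talg_mult (x \<otimes>\<^sub>t y) = talg_inj x * talg_inj y"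
proof -
  have "cbilinear (\<lambda>x y. talg_inj (x :: 'v) * talg_inj y)"
    by (simp add: cbilinear_def clinear_iff talg_scaleC_mult distrib_left distrib_right
        clinear_add[OF clinear_talg_inj] clinear_scaleC[OF clinear_talg_inj])
  from clinear_tensor_lift[OF this] tensor_lift_tens[OF this]
  show "clinear (talg_mult :: ('v, 'v) tensor \<Rightarrow> _)"
    "talg_mult (x \<otimes>\<^sub>t y) = talg_inj x * talg_inj y"
    unfolding talg_mult_def by auto
qed

text \<open>\<open>quot_algebra R\<close> is \<open>T(V)\<close> modulo the two-sided ideal generated by \<open>R\<close>;
  \<^const>\<open>genideal\<close> is two-sided also for noncommutative rings.\<close>

abbreviation talg_ring :: "'v::complex_vector tensor_algebra ring"
  where "talg_ring \<equiv> ring_of_type_algebra"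

definition quot_algebra :: "'v::complex_vector tensor_algebra set \<Rightarrow> 'v tensor_algebra set ring"
  where "quot_algebra R = FactRing talg_ring (genideal talg_ring R)"

definition quot_class ::
    "'v::complex_vector tensor_algebra set \<Rightarrow> 'v tensor_algebra \<Rightarrow> 'v tensor_algebra set"
  where "quot_class R x = a_r_coset talg_ring (genideal talg_ring R) x"

lemma ring_talg_ring: "ring talg_ring"
proof -
  have "\<exists>y. x + y = 0" for x :: "'a tensor_algebra"
    using add.right_inverse by blast
  then show ?thesis
    unfolding ring_of_type_algebra_def using add.right_inverse
    by unfold_locales (auto simp: algebra_simps Units_def)
qed

text \<open>Ring isomorphisms that respect the scalars \<open>c \<cdot> 1\<close>; as \<open>c \<cdot> x = (c \<cdot> 1) x\<close> these are the
  isomorphisms of unital complex algebras.\<close>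

definition algebra_iso :: "'v::complex_vector tensor_algebra set \<Rightarrow> 'w::complex_vector tensor_algebra set
    \<Rightarrow> ('v tensor_algebra set \<Rightarrow> 'w tensor_algebra set) set"
  where "algebra_iso R S = {\<phi> \<in> ring_iso (quot_algebra R) (quot_algebra S).
     \<forall>c. \<phi> (quot_class R (c *\<^sub>C 1)) = quot_class S (c *\<^sub>C 1)}"

text \<open>The type \<^typ>\<open>bit\<close> is the field of integers mod 2, so \<open>i + j\<close> below is the sum of degrees
  mod 2. A family \<open>G\<close> assigns to a degree the subspace of homogeneous elements of that degree;
  quantifying over \<open>i\<close> and \<open>\<xi> \<in> G i\<close> amounts to quantifying over homogeneous \<open>\<xi>\<close> with \<open>|\<xi>| = i\<close>
  (with \<open>0\<close> occurring in both degrees).\<close>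

definition Z2_grading :: "(bit \<Rightarrow> 'g::complex_vector set) \<Rightarrow> bool"
  where "Z2_grading G \<longleftrightarrow> (\<forall>i. complex_vector.subspace (G i)) \<and>
     (\<forall>x. \<exists>!(y, z). y \<in> G 0 \<and> z \<in> G 1 \<and> x = y + z)"

definition tensor_grading :: "(bit \<Rightarrow> 'g::complex_vector set) \<Rightarrow> bit \<Rightarrow> ('g, 'g) tensor set"
  where "tensor_grading G k =
     complex_vector.span {\<xi> \<otimes>\<^sub>t \<eta> | i j \<xi> \<eta>. i + j = k \<and> \<xi> \<in> G i \<and> \<eta> \<in> G j}"

definition degree_preserving :: "(bit \<Rightarrow> 'a set) \<Rightarrow> (bit \<Rightarrow> 'b set) \<Rightarrow> ('a \<Rightarrow> 'b) \<Rightarrow> bool"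
  where "degree_preserving A B f \<longleftrightarrow> (\<forall>k. f ` A k \<subseteq> B k)"

text \<open>\<open>koszul i j\<close> is \<open>(-1)\<^bsup>ij\<^esup>\<close>.\<close>

definition koszul :: "bit \<Rightarrow> bit \<Rightarrow> complex"
  where "koszul i j = (if i = 1 \<and> j = 1 then - 1 else 1)"

definition super_Jacobi :: "(bit \<Rightarrow> 'g::complex_vector set) \<Rightarrow> (('g, 'g) tensor \<Rightarrow> 'g) \<Rightarrow> bool"
  where "super_Jacobi G br \<longleftrightarrow> (\<forall>i j k. \<forall>\<xi>\<in>G i. \<forall>\<eta>\<in>G j. \<forall>\<zeta>\<in>G k.
     br (\<xi> \<otimes>\<^sub>t br (\<eta> \<otimes>\<^sub>t \<zeta>))
       = br (br (\<xi> \<otimes>\<^sub>t \<eta>) \<otimes>\<^sub>t \<zeta>) + koszul i j *\<^sub>C br (\<eta> \<otimes>\<^sub>t br (\<xi> \<otimes>\<^sub>t \<zeta>)))"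

definition graded_antisymmetric ::
    "(bit \<Rightarrow> 'g::complex_vector set) \<Rightarrow> (('g, 'g) tensor \<Rightarrow> 'g) \<Rightarrow> bool"
  where "graded_antisymmetric G br \<longleftrightarrow> (\<forall>i j. \<forall>\<xi>\<in>G i. \<forall>\<eta>\<in>G j.
     br (\<xi> \<otimes>\<^sub>t \<eta>) = - (koszul i j *\<^sub>C br (\<eta> \<otimes>\<^sub>t \<xi>)))"

definition super_Lie_algebra ::
    "(bit \<Rightarrow> 'g::complex_vector set) \<Rightarrow> (('g, 'g) tensor \<Rightarrow> 'g) \<Rightarrow> bool"
  where "super_Lie_algebra G br \<longleftrightarrow> Z2_grading G \<and> clinear br \<and>
     degree_preserving (tensor_grading G) G br \<and> super_Jacobi G br \<and> graded_antisymmetric G br"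

text \<open>\<open>V = \<complex> \<oplus> g\<close> is the product space; \<open>unitV\<close> is \<open>1 \<in> \<complex> \<subset> V\<close> and \<open>inV\<close> the inclusion of \<open>g\<close>.\<close>

type_synonym 'g ext = "complex \<times> 'g"

abbreviation unitV :: "'g::complex_vector ext" where "unitV \<equiv> (1, 0)"

abbreviation inV :: "'g::complex_vector \<Rightarrow> 'g ext" where "inV \<xi> \<equiv> (0, \<xi>)"

definition is_Psi :: "(bit \<Rightarrow> 'g::complex_vector set) \<Rightarrow> (('g, 'g) tensor \<Rightarrow> 'g)
    \<Rightarrow> (('g ext, 'g ext) tensor \<Rightarrow> ('g ext, 'g ext) tensor) \<Rightarrow> bool"
  where "is_Psi G br P \<longleftrightarrow> clinear P \<and>
     P (unitV \<otimes>\<^sub>t unitV) = unitV \<otimes>\<^sub>t unitV \<and>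
     (\<forall>i. \<forall>\<xi>\<in>G i. P (unitV \<otimes>\<^sub>t inV \<xi>) = inV \<xi> \<otimes>\<^sub>t unitV) \<and>
     (\<forall>i. \<forall>\<xi>\<in>G i. P (inV \<xi> \<otimes>\<^sub>t unitV) = unitV \<otimes>\<^sub>t inV \<xi>) \<and>
     (\<forall>i j. \<forall>\<xi>\<in>G i. \<forall>\<eta>\<in>G j. P (inV \<xi> \<otimes>\<^sub>t inV \<eta>)
        = koszul i j *\<^sub>C (inV \<eta> \<otimes>\<^sub>t inV \<xi>) + inV (br (\<xi> \<otimes>\<^sub>t \<eta>)) \<otimes>\<^sub>t unitV)"

definition Psi :: "(bit \<Rightarrow> 'g::complex_vector set) \<Rightarrow> (('g, 'g) tensor \<Rightarrow> 'g)
    \<Rightarrow> ('g ext, 'g ext) tensor \<Rightarrow> ('g ext, 'g ext) tensor"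
  where "Psi G br = (THE P. is_Psi G br P)"

lemma Z2_gradingE:
  assumes "Z2_grading G"
  obtains p q where "clinear p" "clinear q" "\<And>x. p x \<in> G 0" "\<And>x. q x \<in> G 1" "\<And>x. x = p x + q x"
    "\<And>x. x \<in> G 0 \<Longrightarrow> p x = x \<and> q x = 0" "\<And>x. x \<in> G 1 \<Longrightarrow> p x = 0 \<and> q x = x"
proof -
  have sub: "complex_vector.subspace (G i)" for i
    using assms by (simp add: Z2_grading_def)
  have ex: "\<exists>!(y, z). y \<in> G 0 \<and> z \<in> G 1 \<and> x = y + z" for x
    using assms by (simp add: Z2_grading_def)
  then have "\<forall>x. \<exists>y z. y \<in> G 0 \<and> z \<in> G 1 \<and> x = y + z" by (fast dest: ex1_implies_ex)
  then obtain p q where pq: "\<And>x. p x \<in> G 0" "\<And>x. q x \<in> G 1" "\<And>x. x = p x + q x"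
    by metis
  have uniq: "p x = y \<and> q x = z" if "y \<in> G 0" "z \<in> G 1" "x = y + z" for x y z
  proof -
    have "(\<lambda>(y, z). y \<in> G 0 \<and> z \<in> G 1 \<and> x = y + z) (p x, q x)"
      "(\<lambda>(y, z). y \<in> G 0 \<and> z \<in> G 1 \<and> x = y + z) (y, z)"
      unfolding prod.case using pq(1,2) pq(3)[of x] that by blast+
    with ex[of x] have "(p x, q x) = (y, z)" by blast
    then show ?thesis by simp
  qed
  have add: "p (x + y) = p x + p y \<and> q (x + y) = q x + q y" for x y
  proof (rule uniq)
    show "x + y = p x + p y + (q x + q y)"
      by (subst pq(3)[of x], subst pq(3)[of y]) (simp only: ac_simps)
  qed (auto intro: complex_vector.subspace_add[OF sub] pq(1,2))
  have scale: "p (c *\<^sub>C x) = c *\<^sub>C p x \<and> q (c *\<^sub>C x) = c *\<^sub>C q x" for c x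
  proof (rule uniq)
    show "c *\<^sub>C x = c *\<^sub>C p x + c *\<^sub>C q x"
      by (subst pq(3)[of x]) (rule scaleC_right_distrib)
  qed (auto intro: complex_vector.subspace_scale[OF sub] pq(1,2))
  show thesis
  proof (rule that[of p q])
    show "clinear p" "clinear q" using add scale by (auto simp: clinear_iff)
    show "x \<in> G 0 \<Longrightarrow> p x = x \<and> q x = 0" "x \<in> G 1 \<Longrightarrow> p x = 0 \<and> q x = x" for x
      by (rule uniq; simp add: complex_vector.subspace_0[OF sub])+
    show "x = p x + q x" for x by (rule pq(3))
  qed (rule pq(1,2))+
qed

lemma Psi_ex1:
  fixes G :: "bit \<Rightarrow> 'g::complex_vector set" and br :: "('g, 'g) tensor \<Rightarrow> 'g"
  assumes G: "Z2_grading G" and br: "clinear br"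
  shows "\<exists>!P. is_Psi G br P"
proof (rule ex_ex1I)
  obtain p q where p: "clinear p" and q: "clinear q"
    and pq: "\<And>x. p x \<in> G 0" "\<And>x. q x \<in> G 1" "\<And>x. x = p x + q x"
    "\<And>x. x \<in> G 0 \<Longrightarrow> p x = x \<and> q x = 0" "\<And>x. x \<in> G 1 \<Longrightarrow> p x = 0 \<and> q x = x"
    by (rule Z2_gradingE[OF G]) blast
  define r where "r x = p x - q x" for x
  define B where "B v w =
      (fst v * fst w) *\<^sub>C (unitV \<otimes>\<^sub>t unitV) + fst v *\<^sub>C (inV (snd w) \<otimes>\<^sub>t unitV)
      + fst w *\<^sub>C (unitV \<otimes>\<^sub>t inV (snd v)) + inV (snd w) \<otimes>\<^sub>t inV (p (snd v))
      + inV (r (snd w)) \<otimes>\<^sub>t inV (q (snd v)) + inV (br (snd v \<otimes>\<^sub>t snd w)) \<otimes>\<^sub>t unitV"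
    for v w :: "'g ext"
  have inV_add: "inV (x + y) = inV x + inV y" for x y :: 'g by simp
  have inV_scale: "inV (c *\<^sub>C x) = c *\<^sub>C inV x" for c and x :: 'g
    by (simp add: scaleC_prod_def)
  have fs: "fst (c *\<^sub>C v) = c * fst v" "snd (c *\<^sub>C v) = c *\<^sub>C snd v" for c and v :: "'g ext"
    by (simp_all add: scaleC_prod_def scaleC_complex_def)
  have pq_lin: "p (x + y) = p x + p y" "q (x + y) = q x + q y"
    "p (c *\<^sub>C x) = c *\<^sub>C p x" "q (c *\<^sub>C x) = c *\<^sub>C q x" for x y c
    using p q by (simp_all add: clinear_iff)
  have r_lin: "r (x + y) = r x + r y" "r (c *\<^sub>C x) = c *\<^sub>C r x" for x y c
    by (simp_all add: r_def pq_lin complex_vector.scale_right_diff_distrib)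
  have br_lin: "br (x + y) = br x + br y" "br (c *\<^sub>C x) = c *\<^sub>C br x" for x y c
    using br by (simp_all add: clinear_iff)
  note lin = inV_add inV_scale fs pq_lin r_lin br_lin tens_lin fst_add snd_add
    scaleC_left_distrib scaleC_right_distrib scaleC_scaleC distrib_left distrib_right
  have bil_add: "cbilinear (\<lambda>v w. f v w + g v w)" if "cbilinear f" "cbilinear g"
    for f g :: "'g ext \<Rightarrow> 'g ext \<Rightarrow> ('g ext, 'g ext) tensor"
    using that by (simp add: cbilinear_def clinear_iff scaleC_right_distrib add_ac)
  have bil: "cbilinear B"
    unfolding B_def
  proof (intro bil_add)
    show "cbilinear (\<lambda>(v :: 'g ext) (w :: 'g ext). (fst v * fst w) *\<^sub>C (unitV \<otimes>\<^sub>t unitV :: ('g ext, 'g ext) tensor))"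
      unfolding cbilinear_def clinear_iff by (intro conjI allI) (simp_all only: lin mult_ac)
    show "cbilinear (\<lambda>(v :: 'g ext) (w :: 'g ext). fst v *\<^sub>C (inV (snd w) \<otimes>\<^sub>t unitV :: ('g ext, 'g ext) tensor))"
      unfolding cbilinear_def clinear_iff by (intro conjI allI) (simp_all only: lin mult_ac)
    show "cbilinear (\<lambda>(v :: 'g ext) (w :: 'g ext). fst w *\<^sub>C (unitV \<otimes>\<^sub>t inV (snd v) :: ('g ext, 'g ext) tensor))"
      unfolding cbilinear_def clinear_iff by (intro conjI allI) (simp_all only: lin mult_ac)
    show "cbilinear (\<lambda>(v :: 'g ext) (w :: 'g ext). inV (snd w) \<otimes>\<^sub>t inV (p (snd v)))"
      unfolding cbilinear_def clinear_iff by (intro conjI allI) (simp_all only: lin mult_ac)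
    show "cbilinear (\<lambda>(v :: 'g ext) (w :: 'g ext). inV (r (snd w)) \<otimes>\<^sub>t inV (q (snd v)))"
      unfolding cbilinear_def clinear_iff by (intro conjI allI) (simp_all only: lin mult_ac)
    show "cbilinear (\<lambda>(v :: 'g ext) (w :: 'g ext). inV (br (snd v \<otimes>\<^sub>t snd w)) \<otimes>\<^sub>t unitV)"
      unfolding cbilinear_def clinear_iff by (intro conjI allI) (simp_all only: lin mult_ac)
  qed
  have T: "clinear (tensor_lift B)" "tensor_lift B (v \<otimes>\<^sub>t w) = B v w" for v w
    using clinear_tensor_lift[OF bil] tensor_lift_tens[OF bil] by auto
  have z: "(0, 0) \<otimes>\<^sub>t v = 0" "v \<otimes>\<^sub>t (0, 0) = 0" for v :: "'g ext"
    using tens_add_left[of "(0, 0)" "(0, 0)" v] tens_add_right[of v "(0, 0)" "(0, 0)"] by simp_all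
  have z': "0 \<otimes>\<^sub>t x = 0" "x \<otimes>\<^sub>t 0 = 0" for x :: 'g
    using tens_add_left[of 0 0 x] tens_add_right[of x 0 0] by simp_all
  have z0: "p 0 = 0" "q 0 = 0" "br 0 = 0"
    using p q br by (simp_all add: clinear_zero)
  have neg: "inV (- \<eta>) \<otimes>\<^sub>t w = (- 1) *\<^sub>C (inV \<eta> \<otimes>\<^sub>t w)" for \<eta> :: 'g and w :: "'g ext"
    by (simp add: tens_scaleC_left[symmetric] scaleC_prod_def)
  have hom: "p x = (if i = 0 then x else 0)" "q x = (if i = 0 then 0 else x)" if "x \<in> G i" for i x
    using that pq(4,5)[of x] by (cases i; simp)+
  have "is_Psi G br (tensor_lift B)"
    unfolding is_Psi_def T(2)
  proof (intro conjI allI ballI)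
    fix i j \<xi> \<eta>
    assume "\<xi> \<in> G i" "\<eta> \<in> G j"
    then show "B (inV \<xi>) (inV \<eta>)
        = koszul i j *\<^sub>C (inV \<eta> \<otimes>\<^sub>t inV \<xi>) + inV (br (\<xi> \<otimes>\<^sub>t \<eta>)) \<otimes>\<^sub>t unitV"
      by (cases i; cases j) (simp_all add: B_def hom z neg koszul_def scaleC_one r_def)
  qed (simp_all add: T(1) B_def z z' z0 scaleC_one r_def)
  then show "\<exists>P. is_Psi G br P" by blast
next
  obtain p q where pq: "\<And>x. p x \<in> G 0" "\<And>x. q x \<in> G 1" "\<And>x. x = p x + q x"
    by (rule Z2_gradingE[OF G]) blast
  fix P P' assume P: "is_Psi G br P" and P': "is_Psi G br P'"
  have lin: "clinear P" "clinear P'" using P P' by (auto simp: is_Psi_def)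
  have dec: "\<exists>a x y. v = a *\<^sub>C unitV + inV x + inV y \<and> x \<in> G 0 \<and> y \<in> G 1" for v
  proof (intro exI conjI)
    show "v = fst v *\<^sub>C unitV + inV (p (snd v)) + inV (q (snd v))"
      using pq(3)[of "snd v", symmetric] by (simp add: prod_eq_iff scaleC_prod_def scaleC_complex_def)
  qed (rule pq(1,2))+
  show "P = P'"
  proof (rule tensor_ext[OF lin])
    fix v w
    obtain a x y b x' y' where v: "v = a *\<^sub>C unitV + inV x + inV y" "x \<in> G 0" "y \<in> G 1"
      and w: "w = b *\<^sub>C unitV + inV x' + inV y'" "x' \<in> G 0" "y' \<in> G 1"
      using dec by metis
    have eq: "P (unitV \<otimes>\<^sub>t unitV) = P' (unitV \<otimes>\<^sub>t unitV)"
      "\<And>i \<xi>. \<xi> \<in> G i \<Longrightarrow> P (unitV \<otimes>\<^sub>t inV \<xi>) = P' (unitV \<otimes>\<^sub>t inV \<xi>)"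
      "\<And>i \<xi>. \<xi> \<in> G i \<Longrightarrow> P (inV \<xi> \<otimes>\<^sub>t unitV) = P' (inV \<xi> \<otimes>\<^sub>t unitV)"
      "\<And>i j \<xi> \<eta>. \<xi> \<in> G i \<Longrightarrow> \<eta> \<in> G j \<Longrightarrow> P (inV \<xi> \<otimes>\<^sub>t inV \<eta>) = P' (inV \<xi> \<otimes>\<^sub>t inV \<eta>)"
      using P P' unfolding is_Psi_def by metis+
    show "P (v \<otimes>\<^sub>t w) = P' (v \<otimes>\<^sub>t w)"
      unfolding v(1) w(1) tens_lin clinear_add[OF lin(1)] clinear_add[OF lin(2)]
        clinear_scaleC[OF lin(1)] clinear_scaleC[OF lin(2)]
      by (simp only: eq(1) eq(2)[OF v(2)] eq(2)[OF v(3)] eq(2)[OF w(2)] eq(2)[OF w(3)]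
          eq(3)[OF v(2)] eq(3)[OF v(3)] eq(4)[OF v(2) w(2)] eq(4)[OF v(2) w(3)]
          eq(4)[OF v(3) w(2)] eq(4)[OF v(3) w(3)])
  qed
qed

lemma is_Psi_Psi: "Z2_grading G \<Longrightarrow> clinear br \<Longrightarrow> is_Psi G br (Psi G br)"
  unfolding Psi_def by (rule theI'[OF Psi_ex1])

text \<open>\<open>V \<otimes> V \<otimes> V\<close> is modelled as \<open>(V \<otimes> V) \<otimes> V\<close>, and \<open>id \<otimes> \<Psi>\<close> is transported along the
  associator.\<close>

definition on12 :: "(('v::complex_vector, 'v) tensor \<Rightarrow> ('v, 'v) tensor)
    \<Rightarrow> (('v, 'v) tensor, 'v) tensor \<Rightarrow> (('v, 'v) tensor, 'v) tensor"
  where "on12 P = tensor_map P id"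

definition on23 :: "(('v::complex_vector, 'v) tensor \<Rightarrow> ('v, 'v) tensor)
    \<Rightarrow> (('v, 'v) tensor, 'v) tensor \<Rightarrow> (('v, 'v) tensor, 'v) tensor"
  where "on23 P = tensor_unassoc \<circ> tensor_map id P \<circ> tensor_assoc"

definition braid_relation :: "(('v::complex_vector, 'v) tensor \<Rightarrow> ('v, 'v) tensor) \<Rightarrow> bool"
  where "braid_relation P \<longleftrightarrow> on23 P \<circ> on12 P \<circ> on23 P = on12 P \<circ> on23 P \<circ> on12 P"

definition enveloping_relators ::
    "(bit \<Rightarrow> 'g::complex_vector set) \<Rightarrow> (('g, 'g) tensor \<Rightarrow> 'g) \<Rightarrow> 'g tensor_algebra set"
  where "enveloping_relators G br =
     {talg_inj \<xi> * talg_inj \<eta> - koszul i j *\<^sub>C (talg_inj \<eta> * talg_inj \<xi>) - talg_inj (br (\<xi> \<otimes>\<^sub>t \<eta>))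
        | i j \<xi> \<eta>. \<xi> \<in> G i \<and> \<eta> \<in> G j}"

definition Psi_relators ::
    "(bit \<Rightarrow> 'g::complex_vector set) \<Rightarrow> (('g, 'g) tensor \<Rightarrow> 'g) \<Rightarrow> 'g ext tensor_algebra set"
  where "Psi_relators G br =
     insert (talg_inj unitV - 1) {talg_mult (Psi G br t) - talg_mult t | t. True}"

end

(* All the maps involved are linear, so (i) and (ii) only have to be evaluated on tensors of the
   generators 1 and xi (homogeneous) of V. The two sides of the braid relation agree whenever a
   factor is 1, and on xi (x) eta (x) zeta they differ exactly by the super-Jacobi expression
   tensored with 1 (x) 1; that the bracket preserves degrees is what makes the remaining signs
   match. Likewise (Psi^2 - id)(Psi + id) maps xi (x) eta to s (x) 1 + 1 (x) s, where
   s = [xi, eta] + (-1)^(|xi||eta|) [eta, xi]. Pairing a tensor factor with the projection V -> C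
   detects whether these elements vanish. For (iii), the inclusion g -> V and the map V -> T(g),
   c + xi |-> c 1 + xi, extend to algebra homomorphisms between T(g) and T(V) that are mutually
   inverse modulo the relations. *)

theory Submission
  imports Defs
begin

subsection \<open>Linear maps on tensor products\<close>

lemma clinear_id: "clinear id"
  by (simp add: clinear_iff)

lemma clinear_comp: "clinear g \<Longrightarrow> clinear f \<Longrightarrow> clinear (g \<circ> f)"
  by (simp add: clinear_iff)

lemma clinear_eq_on_span_UNIV:
  assumes "clinear f" "clinear g" "complex_vector.span A = UNIV" "\<And>x. x \<in> A \<Longrightarrow> f x = g x"
  shows "f x = g x"
  by (rule vector_space_pair.linear_eq_on[OF _ assms(1,2), where B = A])
    (simp_all add: vector_space_pair_def complex_vector.vector_space_axioms assms(3,4))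

lemma tens_zero: "x \<otimes>\<^sub>t 0 = 0" "0 \<otimes>\<^sub>t y = 0"
  using tens_add_right[of x 0 0] tens_add_left[of 0 0 y] by simp_all

text \<open>\<open>is_Psi\<close> prescribes values on homogeneous vectors only, so linear maps have
  to be compared on tensors of spanning sets. Induction over the span, first in the right factor and
  then in the left, reaches every pure tensor; the class of \<open>single k c\<close> is a multiple
  of one.\<close>

lemma span_tens:
  assumes A: "complex_vector.span A = UNIV" and B: "complex_vector.span B = UNIV"
  shows "complex_vector.span {x \<otimes>\<^sub>t y | x y. x \<in> A \<and> y \<in> B} = UNIV" (is "?S = _")
proof -
  note span = complex_vector.span_zero complex_vector.span_add complex_vector.span_scale
  have left: "x \<otimes>\<^sub>t y \<in> ?S" if "x \<in> A" for x y
  proof -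
    have "y \<in> complex_vector.span B" using B by simp
    then show ?thesis
    proof (induction rule: complex_vector.span_induct_alt)
      case (step c y y')
      then have "x \<otimes>\<^sub>t y \<in> ?S" using that by (intro complex_vector.span_base) blast
      with step show ?case by (simp add: tens_lin span)
    qed (simp add: tens_zero span)
  qed
  have tens: "x \<otimes>\<^sub>t y \<in> ?S" for x y
  proof -
    have "x \<in> complex_vector.span A" using A by simp
    then show ?thesis
      by (induction rule: complex_vector.span_induct_alt) (simp_all add: tens_zero tens_lin span left)
  qed
  have "abs_tensor p \<in> ?S" for p
  proof (induction p rule: poly_mapping_add_induct)
    case zero
    show ?case unfolding zero_tensor_def[symmetric] by (rule complex_vector.span_zero)
  next
    case (single k c)
    have "abs_tensor (Poly_Mapping.single k c) = c *\<^sub>C (fst k \<otimes>\<^sub>t snd k)"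
      by (simp add: tens.abs_eq scaleC_tensor.abs_eq scaleC_single scaleC_complex_def)
    then show ?case by (simp add: span tens)
  next
    case (add p q)
    then show ?case unfolding plus_tensor.abs_eq[symmetric] by (rule complex_vector.span_add)
  qed
  then have "t \<in> ?S" for t
    by (subst Quotient_abs_rep[OF Quotient_tensor, symmetric]) (rule \<open>\<And>p. abs_tensor p \<in> ?S\<close>)
  then show ?thesis by blast
qed

lemma tensor_ext_span:
  assumes "clinear f" "clinear g"
    and "complex_vector.span A = UNIV" "complex_vector.span B = UNIV"
    and "\<And>x y. x \<in> A \<Longrightarrow> y \<in> B \<Longrightarrow> f (x \<otimes>\<^sub>t y) = g (x \<otimes>\<^sub>t y)"
  shows "f = g"
  by (rule ext, rule clinear_eq_on_span_UNIV[OF assms(1,2) span_tens[OF assms(3,4)]])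
    (use assms(5) in blast)

text \<open>The pure tensors over \<open>A\<close> and \<open>B\<close> span the first factor of the
  iterated product, so the two-factor case applies once more.\<close>

lemma tensor_ext3_span:
  assumes "clinear f" "clinear g"
    and "complex_vector.span A = UNIV" "complex_vector.span B = UNIV" "complex_vector.span C = UNIV"
    and "\<And>x y z. x \<in> A \<Longrightarrow> y \<in> B \<Longrightarrow> z \<in> C
      \<Longrightarrow> f ((x \<otimes>\<^sub>t y) \<otimes>\<^sub>t z) = g ((x \<otimes>\<^sub>t y) \<otimes>\<^sub>t z)"
  shows "f = g"
  by (rule tensor_ext_span[OF assms(1,2) span_tens[OF assms(3,4)] assms(5)])
    (use assms(6) in blast)

text \<open>Contracting the right factor with the coordinate V \<rightarrow> \<complex> recovers the
  left factor. Used twice, this strips both units from a threefold tensor.\<close>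

lemma tensor_unitV_right_eq_iff:
  fixes x y :: "'v::complex_vector"
  shows "x \<otimes>\<^sub>t (unitV :: 'g::complex_vector ext) = y \<otimes>\<^sub>t unitV \<longleftrightarrow> x = y"
proof
  have "cbilinear (\<lambda>(v :: 'v) (w :: 'g ext). fst w *\<^sub>C v)"
    by (simp add: cbilinear_def clinear_iff scaleC_prod_def scaleC_complex_def
        scaleC_left_distrib scaleC_right_distrib scaleC_scaleC mult_ac)
  note T = tensor_lift_tens[OF this]
  assume "x \<otimes>\<^sub>t (unitV :: 'g ext) = y \<otimes>\<^sub>t unitV"
  then have "tensor_lift (\<lambda>(v :: 'v) (w :: 'g ext). fst w *\<^sub>C v) (x \<otimes>\<^sub>t unitV)
      = tensor_lift (\<lambda>(v :: 'v) (w :: 'g ext). fst w *\<^sub>C v) (y \<otimes>\<^sub>t unitV)"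
    by (rule arg_cong)
  then show "x = y" by (simp add: T scaleC_one)
qed simp

text \<open>Scaling the g-coordinate of the first factor by the \<complex>-coordinate of the second
  separates the summands: the first gives \<open>x\<close>, the second gives 0.\<close>

lemma inV_unitV_sum_eq_0_iff:
  fixes x :: "'g::complex_vector"
  shows "inV x \<otimes>\<^sub>t unitV + unitV \<otimes>\<^sub>t inV x = (0 :: ('g ext, 'g ext) tensor) \<longleftrightarrow> x = 0"
proof
  have bil: "cbilinear (\<lambda>(v :: 'g ext) (w :: 'g ext). fst w *\<^sub>C snd v)"
    by (simp add: cbilinear_def clinear_iff scaleC_prod_def scaleC_complex_def
        scaleC_left_distrib scaleC_right_distrib scaleC_scaleC mult_ac)
  assume "inV x \<otimes>\<^sub>t unitV + unitV \<otimes>\<^sub>t inV x = (0 :: ('g ext, 'g ext) tensor)"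
  then have "tensor_lift (\<lambda>(v :: 'g ext) (w :: 'g ext). fst w *\<^sub>C snd v)
      (inV x \<otimes>\<^sub>t unitV + unitV \<otimes>\<^sub>t inV x) = 0"
    by (simp add: clinear_zero[OF clinear_tensor_lift[OF bil]])
  then show "x = 0"
    by (simp add: clinear_add[OF clinear_tensor_lift[OF bil]] tensor_lift_tens[OF bil] scaleC_one)
next
  show "inV x \<otimes>\<^sub>t unitV + unitV \<otimes>\<^sub>t inV x = (0 :: ('g ext, 'g ext) tensor)" if "x = 0"
    using that by (simp add: tens_zero flip: zero_prod_def)
qed

subsection \<open>Homogeneous generators\<close>

lemma koszul_square [simp]:
  "koszul i j * koszul i j = 1" "koszul i j * (koszul i j * c) = c"
  by (simp_all add: koszul_def)

text \<open>The sign is a bicharacter; together with |[x, y]| = |x| + |y| this evaluates the signs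
  that a bracket picks up when it is moved past a vector.\<close>

lemma koszul_add:
  "koszul (i + j) k = koszul i k * koszul j k" "koszul i (j + k) = koszul i j * koszul i k"
  by (cases i; cases j; cases k; simp add: koszul_def)+

lemma koszul_commute: "koszul i j = koszul j i"
  by (simp add: koszul_def)

text \<open>\<open>add_Pair\<close> rewrites in the opposite direction, so it is kept out of the
  simplifications that use these rules.\<close>

lemma inV_lin:
  "inV (x + y) = inV x + inV y" "inV (c *\<^sub>C x) = c *\<^sub>C inV x"
  by (simp_all add: scaleC_prod_def)

text \<open>The vectors on whose pairwise tensors \<open>is_Psi\<close> fixes the value.\<close>

definition ext_gens :: "(bit \<Rightarrow> 'g::complex_vector set) \<Rightarrow> 'g ext set"
  where "ext_gens G = insert unitV (\<Union>i. inV ` G i)"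

lemma ext_gens_cases: "v \<in> ext_gens G \<Longrightarrow> v = unitV \<or> (\<exists>i x. x \<in> G i \<and> v = inV x)"
  by (auto simp: ext_gens_def)

lemma span_ext_gens:
  assumes "Z2_grading G"
  shows "complex_vector.span (ext_gens G) = UNIV"
proof -
  obtain p q where pq: "\<And>x. p x \<in> G 0" "\<And>x. q x \<in> G 1" "\<And>x. x = p x + q x"
    by (rule Z2_gradingE[OF assms]) blast
  have "v \<in> complex_vector.span (ext_gens G)" for v
  proof -
    have "v = fst v *\<^sub>C unitV + (inV (p (snd v)) + inV (q (snd v)))"
      using pq(3)[of "snd v", symmetric] by (simp add: prod_eq_iff scaleC_prod_def scaleC_complex_def)
    also have "\<dots> \<in> complex_vector.span (ext_gens G)"
      by (intro complex_vector.span_add complex_vector.span_scale complex_vector.span_base)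
        (use pq(1,2) in \<open>auto simp: ext_gens_def\<close>)
    finally show ?thesis .
  qed
  then show ?thesis by blast
qed

lemma span_homogeneous:
  assumes "Z2_grading G"
  shows "complex_vector.span (\<Union>i. G i) = UNIV"
proof -
  obtain p q where pq: "\<And>x. p x \<in> G 0" "\<And>x. q x \<in> G 1" "\<And>x. x = p x + q x"
    by (rule Z2_gradingE[OF assms]) blast
  have "x \<in> complex_vector.span (\<Union>i. G i)" for x
    by (subst pq(3)) (use pq(1,2) in \<open>blast intro: complex_vector.span_add complex_vector.span_base\<close>)
  then show ?thesis by blast
qed

section \<open>Psi on generators, its polynomial relation and its braid relation\<close>

locale graded_bracket =
  fixes G :: "bit \<Rightarrow> 'g::complex_vector set" and br :: "('g, 'g) tensor \<Rightarrow> 'g"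
  assumes grading: "Z2_grading G" and clinear_br: "clinear br"
begin

lemma clinear_Psi: "clinear (Psi G br)"
  using is_Psi_Psi[OF grading clinear_br] by (simp add: is_Psi_def)

lemma Psi_unit_unit: "Psi G br (unitV \<otimes>\<^sub>t unitV) = unitV \<otimes>\<^sub>t unitV"
  using is_Psi_Psi[OF grading clinear_br] by (simp add: is_Psi_def)

text \<open>Both sides are linear in \<open>x\<close> and the homogeneous vectors span g. Hence a
  bracket next to \<open>unitV\<close> can be moved without knowing its degree.\<close>

lemma Psi_unit_inV: "Psi G br (unitV \<otimes>\<^sub>t inV x) = inV x \<otimes>\<^sub>t unitV"
  by (rule clinear_eq_on_span_UNIV[OF _ _ span_homogeneous[OF grading],
        of "\<lambda>x. Psi G br (unitV \<otimes>\<^sub>t inV x)" "\<lambda>x. inV x \<otimes>\<^sub>t unitV"])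
    (use is_Psi_Psi[OF grading clinear_br] in \<open>auto simp: is_Psi_def clinear_iff inV_lin tens_lin
      simp del: add_Pair\<close>)

lemma Psi_inV_unit: "Psi G br (inV x \<otimes>\<^sub>t unitV) = unitV \<otimes>\<^sub>t inV x"
  by (rule clinear_eq_on_span_UNIV[OF _ _ span_homogeneous[OF grading],
        of "\<lambda>x. Psi G br (inV x \<otimes>\<^sub>t unitV)" "\<lambda>x. unitV \<otimes>\<^sub>t inV x"])
    (use is_Psi_Psi[OF grading clinear_br] in \<open>auto simp: is_Psi_def clinear_iff inV_lin tens_lin
      simp del: add_Pair\<close>)

lemma Psi_inV_inV:
  "x \<in> G i \<Longrightarrow> y \<in> G j \<Longrightarrow> Psi G br (inV x \<otimes>\<^sub>t inV y)
     = koszul i j *\<^sub>C (inV y \<otimes>\<^sub>t inV x) + inV (br (x \<otimes>\<^sub>t y)) \<otimes>\<^sub>t unitV"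
  using is_Psi_Psi[OF grading clinear_br] by (simp add: is_Psi_def)

lemmas Psi_simps = clinear_add[OF clinear_Psi] clinear_scaleC[OF clinear_Psi]
  Psi_unit_unit Psi_unit_inV Psi_inV_unit

lemma clinear_on12_Psi: "clinear (on12 (Psi G br))"
  unfolding on12_def by (rule clinear_tensor_map[OF clinear_Psi clinear_id])

lemma clinear_id_Psi: "clinear (tensor_map id (Psi G br))"
  by (rule clinear_tensor_map[OF clinear_id clinear_Psi])

lemma on12_Psi: "on12 (Psi G br) (t \<otimes>\<^sub>t z) = Psi G br t \<otimes>\<^sub>t z"
  unfolding on12_def by (simp add: tensor_map_tens[OF clinear_Psi clinear_id])

lemma clinear_on23_Psi: "clinear (on23 (Psi G br))"
  unfolding on23_def
  by (intro clinear_comp clinear_tensor_assoc clinear_tensor_unassoc clinear_id_Psi)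

text \<open>The value of \<open>Psi\<close> on \<open>y \<otimes>\<^sub>t z\<close> is a sum in
  general, so \<open>tensor_unassoc\<close> stays in place until that value is expanded and
  linearity carries it to pure tensors.\<close>

lemma on23_Psi:
  "on23 (Psi G br) ((x \<otimes>\<^sub>t y) \<otimes>\<^sub>t z) = tensor_unassoc (x \<otimes>\<^sub>t Psi G br (y \<otimes>\<^sub>t z))"
  unfolding on23_def by (simp add: tensor_map_tens[OF clinear_id clinear_Psi])

lemmas braid_simps = Psi_simps on12_Psi on23_Psi clinear_add[OF clinear_on12_Psi]
  clinear_scaleC[OF clinear_on12_Psi] clinear_add[OF clinear_on23_Psi]
  clinear_scaleC[OF clinear_on23_Psi] clinear_add[OF clinear_tensor_unassoc]
  clinear_scaleC[OF clinear_tensor_unassoc] tens_lin scaleC_right_distrib scaleC_scaleC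
  scaleC_one koszul_commute

text \<open>With k the sign, Psi^2 - id maps x \<otimes> y to k [y, x] \<otimes> 1 + 1 \<otimes>
  [x, y] and kills tensors with a unit factor. Adding its value at Psi(x \<otimes> y), which is
  [x, y] \<otimes> 1 + k 1 \<otimes> [y, x], places the same defect of antisymmetry on both sides of
  the unit.\<close>

lemma graded_antisymmetric_iff:
  "(\<lambda>t. Psi G br (Psi G br t) - t) \<circ> (\<lambda>t. Psi G br t + t) = (\<lambda>t. 0)
     \<longleftrightarrow> graded_antisymmetric G br"
    (is "?F = ?Z \<longleftrightarrow> _")
proof -
  have F: "clinear ?F" and Z: "clinear ?Z"
    using clinear_Psi by (auto simp: clinear_iff scaleC_right_distrib
        complex_vector.scale_right_diff_distrib)
  have u: "?F (unitV \<otimes>\<^sub>t unitV) = 0" "?F (unitV \<otimes>\<^sub>t inV x) = 0" "?F (inV x \<otimes>\<^sub>t unitV) = 0" for x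
    by (simp_all add: Psi_simps)
  define S where "S i j x y = br (x \<otimes>\<^sub>t y) + koszul i j *\<^sub>C br (y \<otimes>\<^sub>t x)" for i j x y
  have main: "?F (inV x \<otimes>\<^sub>t inV y)
      = inV (S i j x y) \<otimes>\<^sub>t unitV + unitV \<otimes>\<^sub>t inV (S i j x y)"
    if "x \<in> G i" "y \<in> G j" for i j x y
    using Psi_inV_inV[OF that] Psi_inV_inV[OF that(2,1)]
    by (simp add: Psi_simps S_def inV_lin tens_lin scaleC_right_distrib scaleC_scaleC scaleC_one
        koszul_commute del: add_Pair)
  have anti: "graded_antisymmetric G br \<longleftrightarrow> (\<forall>i j. \<forall>x\<in>G i. \<forall>y\<in>G j. S i j x y = 0)"
    unfolding graded_antisymmetric_def S_def by (simp add: eq_neg_iff_add_eq_0)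
  show ?thesis
  proof
    assume *: "?F = ?Z"
    show "graded_antisymmetric G br"
      unfolding anti
    proof (intro allI ballI)
      fix i j x y assume "x \<in> G i" "y \<in> G j"
      from main[OF this] have "inV (S i j x y) \<otimes>\<^sub>t unitV + unitV \<otimes>\<^sub>t inV (S i j x y) = 0"
        unfolding * by (rule sym)
      then show "S i j x y = 0" by (simp only: inV_unitV_sum_eq_0_iff)
    qed
  next
    assume "graded_antisymmetric G br"
    then have S0: "\<And>i j x y. x \<in> G i \<Longrightarrow> y \<in> G j \<Longrightarrow> S i j x y = 0" by (simp add: anti)
    show "?F = ?Z"
    proof (rule tensor_ext_span[OF F Z span_ext_gens[OF grading] span_ext_gens[OF grading]])
      fix v w assume "v \<in> ext_gens G" "w \<in> ext_gens G"
      moreover have "?F (inV x \<otimes>\<^sub>t inV y) = 0" if "x \<in> G i" "y \<in> G j" for i j x y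
        unfolding main[OF that] inV_unitV_sum_eq_0_iff using S0[OF that] .
      ultimately show "?F (v \<otimes>\<^sub>t w) = 0"
        using u unfolding ext_gens_def by blast
    qed
  qed
qed

text \<open>In front of 1 \<otimes> 1 the left side yields only [x, [y, z]], while the right side
  yields [[x, y], z] and the signed [y, [x, z]]. Terms with at most one bracket agree by
  bimultiplicativity of the sign; for example, moving y past [x, z] and past x leaves the sign of y
  and z, since that of x and y occurs squared.\<close>

lemma braid_relation_iff:
  assumes deg: "degree_preserving (tensor_grading G) G br"
  shows "braid_relation (Psi G br) \<longleftrightarrow> super_Jacobi G br"
proof -
  let ?L = "on23 (Psi G br) \<circ> on12 (Psi G br) \<circ> on23 (Psi G br)"
  let ?R = "on12 (Psi G br) \<circ> on23 (Psi G br) \<circ> on12 (Psi G br)"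
  have L: "clinear ?L" and R: "clinear ?R"
    by (intro clinear_comp clinear_on12_Psi clinear_on23_Psi)+
  \<comment> \<open>Needed to evaluate \<open>Psi\<close> when one of its two arguments is itself a
    bracket.\<close>
  have brG: "br (x \<otimes>\<^sub>t y) \<in> G (i + j)" if "x \<in> G i" "y \<in> G j" for i j x y
  proof -
    have "x \<otimes>\<^sub>t y \<in> tensor_grading G (i + j)"
      unfolding tensor_grading_def by (rule complex_vector.span_base) (use that in blast)
    then show ?thesis using deg unfolding degree_preserving_def by blast
  qed
  have u0: "?L ((unitV \<otimes>\<^sub>t unitV) \<otimes>\<^sub>t unitV) = ?R ((unitV \<otimes>\<^sub>t unitV) \<otimes>\<^sub>t unitV)"
    "?L ((inV x \<otimes>\<^sub>t unitV) \<otimes>\<^sub>t unitV) = ?R ((inV x \<otimes>\<^sub>t unitV) \<otimes>\<^sub>t unitV)"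
    "?L ((unitV \<otimes>\<^sub>t inV x) \<otimes>\<^sub>t unitV) = ?R ((unitV \<otimes>\<^sub>t inV x) \<otimes>\<^sub>t unitV)"
    "?L ((unitV \<otimes>\<^sub>t unitV) \<otimes>\<^sub>t inV x) = ?R ((unitV \<otimes>\<^sub>t unitV) \<otimes>\<^sub>t inV x)" for x
    by (simp_all add: braid_simps)
  have u1: "?L ((inV x \<otimes>\<^sub>t inV y) \<otimes>\<^sub>t unitV) = ?R ((inV x \<otimes>\<^sub>t inV y) \<otimes>\<^sub>t unitV)"
    "?L ((inV x \<otimes>\<^sub>t unitV) \<otimes>\<^sub>t inV y) = ?R ((inV x \<otimes>\<^sub>t unitV) \<otimes>\<^sub>t inV y)"
    "?L ((unitV \<otimes>\<^sub>t inV x) \<otimes>\<^sub>t inV y) = ?R ((unitV \<otimes>\<^sub>t inV x) \<otimes>\<^sub>t inV y)"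
    if "x \<in> G i" "y \<in> G j" for i j x y
    by (simp_all add: braid_simps Psi_inV_inV[OF that])
  define A where "A x y z = br (x \<otimes>\<^sub>t br (y \<otimes>\<^sub>t z))" for x y z
  define B where "B i j x y z
    = br (br (x \<otimes>\<^sub>t y) \<otimes>\<^sub>t z) + koszul i j *\<^sub>C br (y \<otimes>\<^sub>t br (x \<otimes>\<^sub>t z))" for i j x y z
  have main: "\<exists>c. ?L ((inV x \<otimes>\<^sub>t inV y) \<otimes>\<^sub>t inV z) = c + (inV (A x y z) \<otimes>\<^sub>t unitV) \<otimes>\<^sub>t unitV
      \<and> ?R ((inV x \<otimes>\<^sub>t inV y) \<otimes>\<^sub>t inV z) = c + (inV (B i j x y z) \<otimes>\<^sub>t unitV) \<otimes>\<^sub>t unitV"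
    if x: "x \<in> G i" and y: "y \<in> G j" and z: "z \<in> G k" for i j k x y z
  proof -
    note rules = Psi_inV_inV[OF x y] Psi_inV_inV[OF x z] Psi_inV_inV[OF y z]
      Psi_inV_inV[OF x brG[OF y z], unfolded koszul_add]
      Psi_inV_inV[OF y brG[OF x z], unfolded koszul_add]
      Psi_inV_inV[OF brG[OF x y] z, unfolded koszul_add]
    \<comment> \<open>The witness \<open>c\<close> is this common difference: all terms with at most
      one bracket.\<close>
    have "?L ((inV x \<otimes>\<^sub>t inV y) \<otimes>\<^sub>t inV z) - (inV (A x y z) \<otimes>\<^sub>t unitV) \<otimes>\<^sub>t unitV
      = ?R ((inV x \<otimes>\<^sub>t inV y) \<otimes>\<^sub>t inV z) - (inV (B i j x y z) \<otimes>\<^sub>t unitV) \<otimes>\<^sub>t unitV"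
      by (simp add: braid_simps rules A_def B_def inV_lin algebra_simps del: add_Pair)
    then show ?thesis by (metis diff_add_cancel)
  qed
  have iff: "?L ((inV x \<otimes>\<^sub>t inV y) \<otimes>\<^sub>t inV z) = ?R ((inV x \<otimes>\<^sub>t inV y) \<otimes>\<^sub>t inV z)
      \<longleftrightarrow> A x y z = B i j x y z"
    if "x \<in> G i" "y \<in> G j" "z \<in> G k" for i j k x y z
    \<comment> \<open>Cancel \<open>c\<close>, strip the two units, and compare second
      components.\<close>
    using main[OF that] tensor_unitV_right_eq_iff by (metis add_left_cancel prod.inject)
  show ?thesis
  proof
    assume "braid_relation (Psi G br)"
    then show "super_Jacobi G br"
      using iff unfolding braid_relation_def super_Jacobi_def A_def B_def by metis
  next
    assume J: "super_Jacobi G br"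
    have u2: "?L ((inV x \<otimes>\<^sub>t inV y) \<otimes>\<^sub>t inV z) = ?R ((inV x \<otimes>\<^sub>t inV y) \<otimes>\<^sub>t inV z)"
      if "x \<in> G i" "y \<in> G j" "z \<in> G k" for i j k x y z
      using J iff[OF that] that unfolding super_Jacobi_def A_def B_def by blast
    note span = span_ext_gens[OF grading]
    show "braid_relation (Psi G br)"
      unfolding braid_relation_def
    proof (rule tensor_ext3_span[OF L R span span span])
      fix u v w assume *: "u \<in> ext_gens G" "v \<in> ext_gens G" "w \<in> ext_gens G"
      \<comment> \<open>Keeps the equation opaque, so that the eight cases (each factor a unit or in
        g) match \<open>u0\<close>, \<open>u1\<close> and \<open>u2\<close> without unfolding the
        composites.\<close>
      define P where "P u v w \<longleftrightarrow> ?L ((u \<otimes>\<^sub>t v) \<otimes>\<^sub>t w) = ?R ((u \<otimes>\<^sub>t v) \<otimes>\<^sub>t w)" for u v w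
      note u = u0[folded P_def] u1[folded P_def] u2[folded P_def]
      have "P u v w"
        using *[THEN ext_gens_cases] by (elim disjE exE conjE) (simp_all add: u)
      then show "?L ((u \<otimes>\<^sub>t v) \<otimes>\<^sub>t w) = ?R ((u \<otimes>\<^sub>t v) \<otimes>\<^sub>t w)"
        unfolding P_def .
    qed
  qed
qed

end

subsection \<open>The universal property of the tensor algebra\<close>

text \<open>A common setting in which T(g) and T(V) can both be targets of the universal
  property.\<close>

class complex_algebra_1 = ring_1 + complex_vector +
  assumes mult_scaleC_left: "(c *\<^sub>C x) * y = c *\<^sub>C (x * y)"
    and mult_scaleC_right: "x * (c *\<^sub>C y) = c *\<^sub>C (x * y)"

instance tensor_algebra :: (complex_vector) complex_algebra_1
  by standard (rule talg_scaleC_mult)+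

lemma abs_tensor_algebra_surj: "\<exists>p. t = abs_tensor_algebra p"
  by (metis Quotient_abs_rep[OF Quotient_tensor_algebra])

text \<open>Words arise from the empty word, which is 1, by multiplying with generators on the left,
  and every element is a linear combination of words.\<close>

lemma tensor_algebra_induct [case_names one inj_mult add scaleC]:
  assumes one: "P 1" and inj_mult: "\<And>v t. P t \<Longrightarrow> P (talg_inj v * t)"
    and add: "\<And>s t. P s \<Longrightarrow> P t \<Longrightarrow> P (s + t)" and scaleC: "\<And>c t. P t \<Longrightarrow> P (c *\<^sub>C t)"
  shows "P t"
proof -
  have word: "P (abs_tensor_algebra (Poly_Mapping.single w 1))" for w
  proof (induction w)
    case Nil
    show ?case using one by (simp add: one_tensor_algebra_def zero_list_def flip: single_one)
  next
    case (Cons v w)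
    have "abs_tensor_algebra (Poly_Mapping.single (v # w) 1)
        = talg_inj v * abs_tensor_algebra (Poly_Mapping.single w 1)"
      by (simp add: talg_inj.abs_eq times_tensor_algebra.abs_eq mult_single plus_list_def)
    with Cons inj_mult show ?case by simp
  qed
  have "P (abs_tensor_algebra p)" for p
  proof (induction p rule: poly_mapping_add_induct)
    case zero
    \<comment> \<open>Zero has no case of its own: it is 0 times 1.\<close>
    show ?case using scaleC[OF one, of 0] by (simp add: zero_tensor_algebra_def)
  next
    case (single w c)
    have "abs_tensor_algebra (Poly_Mapping.single w c)
        = c *\<^sub>C abs_tensor_algebra (Poly_Mapping.single w 1)"
      by (simp add: scaleC_tensor_algebra.abs_eq scaleC_single scaleC_complex_def)
    with word scaleC show ?case by simp
  next
    case (add p q)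
    with assms(3) show ?case by (simp flip: plus_tensor_algebra.abs_eq)
  qed
  then show ?thesis using abs_tensor_algebra_surj by metis
qed

definition algebra_hom ::
    "('a::complex_algebra_1 \<Rightarrow> 'b::complex_algebra_1) \<Rightarrow> bool"
  where "algebra_hom F \<longleftrightarrow> clinear F \<and> F 1 = 1 \<and> (\<forall>x y. F (x * y) = F x * F y)"

text \<open>A word is sent to the product of the images of its letters; linearity of
  \<open>f\<close> and bilinearity of the product kill the multilinearity relators. Only existence
  is obtained here.\<close>

lemma tensor_algebra_universal:
  fixes f :: "'v::complex_vector \<Rightarrow> 'a::complex_algebra_1"
  assumes f: "clinear f"
  obtains F where "algebra_hom F" "\<And>v. F (talg_inj v) = f v"
proof -
  define E where "E = free_ext (\<lambda>w. prod_list (map f w))"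
  have E: "clinear E" unfolding E_def by (rule clinear_free_ext)
  have E_single: "E (Poly_Mapping.single w c) = c *\<^sub>C prod_list (map f w)" for w c
    by (simp add: E_def)
  have ker: "E p = 0" if "p \<in> complex_vector.span talg_relators" for p
    using that
  proof (induction rule: complex_vector.span_induct_alt)
    case base
    show ?case using E by (rule clinear_zero)
  next
    case (step c x y)
    have "E x = 0"
      using step(1) f unfolding talg_relators_def clinear_iff
      by (auto simp: clinear_minus[OF E] E_single scaleC_one distrib_left distrib_right
          mult_scaleC_left mult_scaleC_right)
    with step show ?case by (simp add: clinear_add[OF E] clinear_scaleC[OF E])
  qed
  define F where "F t = E (rep_tensor_algebra t)" for t
  have F: "F (abs_tensor_algebra p) = E p" for p
  proof -
    have "talg_rel (rep_tensor_algebra (abs_tensor_algebra p)) p"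
      by (metis Quotient_tensor_algebra Quotient_rep_abs talg_rel_refl)
    then have "E (rep_tensor_algebra (abs_tensor_algebra p) - p) = 0"
      unfolding talg_rel_def by (rule ker)
    then show ?thesis by (simp add: F_def clinear_minus[OF E])
  qed
  have E_mult: "E (p * q) = E p * E q" for p q
  proof (induction p rule: poly_mapping_add_induct)
    case zero
    show ?case by (simp add: clinear_zero[OF E])
  next
    case (single w c)
    show ?case
    proof (induction q rule: poly_mapping_add_induct)
      case zero
      show ?case by (simp add: clinear_zero[OF E])
    next
      case (single w' c')
      show ?case
        by (simp add: mult_single E_single plus_list_def mult_scaleC_left mult_scaleC_right
            scaleC_scaleC mult_ac)
    next
      case (add p q)
      then show ?case by (simp add: distrib_left clinear_add[OF E])
    qed
  next
    case (add p q)
    then show ?case by (simp add: distrib_right clinear_add[OF E])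
  qed
  have "algebra_hom F"
    unfolding algebra_hom_def
  proof (intro conjI allI clinearI)
    show "F 1 = 1"
      by (simp add: one_tensor_algebra_def F E_single scaleC_one zero_list_def flip: single_one)
    fix s t :: "'v tensor_algebra" and c
    obtain p q where "s = abs_tensor_algebra p" "t = abs_tensor_algebra q"
      using abs_tensor_algebra_surj by metis
    then show "F (s + t) = F s + F t" "F (s * t) = F s * F t" "F (c *\<^sub>C s) = c *\<^sub>C F s"
      by (simp_all add: plus_tensor_algebra.abs_eq scaleC_tensor_algebra.abs_eq
          times_tensor_algebra.abs_eq F clinear_add[OF E] clinear_scaleC[OF E] E_mult)
  qed
  moreover have "F (talg_inj v) = f v" for v
    by (simp add: talg_inj.abs_eq F E_single scaleC_one)
  ultimately show thesis by (rule that)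
qed

subsection \<open>Isomorphisms of quotients of tensor algebras\<close>

lemma talg_ring_simps [simp]:
  "carrier talg_ring = UNIV" "monoid.mult talg_ring = (*)" "monoid.one talg_ring = 1"
  "ring.zero talg_ring = 0" "ring.add talg_ring = (+)"
  by (simp_all add: ring_of_type_algebra_def)

lemma a_minus_talg_ring [simp]: "x \<ominus>\<^bsub>talg_ring\<^esub> y = x - y" for x y :: "'v::complex_vector tensor_algebra"
proof -
  interpret ring "talg_ring :: 'v tensor_algebra ring" by (rule ring_talg_ring)
  have "\<ominus>\<^bsub>talg_ring\<^esub> y = - y" by (rule minus_equality) simp_all
  then show ?thesis by (simp add: a_minus_def)
qed

lemma ideal_genideal_talg_ring: "ideal (genideal talg_ring R) talg_ring"
  by (rule ring.genideal_ideal[OF ring_talg_ring]) simp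

lemma quot_class_eq_iff: "quot_class R x = quot_class R y \<longleftrightarrow> x - y \<in> genideal talg_ring R"
  unfolding quot_class_def
  using ring.quotient_eq_iff_same_a_r_cos[OF ring_talg_ring ideal_genideal_talg_ring, of x y R]
  by simp

lemma quot_class_ring_hom: "quot_class R \<in> ring_hom talg_ring (quot_algebra R)"
  unfolding quot_class_def quot_algebra_def
  by (rule ideal.rcos_ring_hom[OF ideal_genideal_talg_ring])

lemma ring_quot_algebra: "ring (quot_algebra R)"
  unfolding quot_algebra_def by (rule ideal.quotient_is_ring[OF ideal_genideal_talg_ring])

lemma carrier_quot_algebra: "carrier (quot_algebra R) = range (quot_class R)"
  by (auto simp: quot_algebra_def quot_class_def FactRing_simps a_r_coset_def)

lemma
  fixes R :: "'v::complex_vector tensor_algebra set"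
  shows quot_class_zero: "quot_class R 0 = \<zero>\<^bsub>quot_algebra R\<^esub>"
    and quot_class_mult: "quot_class R (x * y) = quot_class R x \<otimes>\<^bsub>quot_algebra R\<^esub> quot_class R y"
    and quot_class_add: "quot_class R (x + y) = quot_class R x \<oplus>\<^bsub>quot_algebra R\<^esub> quot_class R y"
  using ring_hom_zero[OF quot_class_ring_hom ring_talg_ring ring_quot_algebra, of R]
    ring_hom_mult[OF quot_class_ring_hom, of x y R]
    ring_hom_add[OF quot_class_ring_hom, of x y R]
  by simp_all

lemma scaleC_eq_mult: "c *\<^sub>C x = (c *\<^sub>C 1) * x" for x :: "'a::complex_algebra_1"
  by (simp add: mult_scaleC_left)

lemma algebra_hom_comp: "algebra_hom F \<Longrightarrow> algebra_hom H \<Longrightarrow> algebra_hom (F \<circ> H)"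
  by (simp add: algebra_hom_def clinear_iff)

lemma algebra_hom_id: "algebra_hom id"
  by (simp add: algebra_hom_def clinear_iff)

lemma algebra_hom_scaleC: "algebra_hom F \<Longrightarrow> F (c *\<^sub>C x) = c *\<^sub>C F x"
  and algebra_hom_add: "algebra_hom F \<Longrightarrow> F (x + y) = F x + F y"
  and algebra_hom_zero: "algebra_hom F \<Longrightarrow> F 0 = 0"
  and algebra_hom_diff: "algebra_hom F \<Longrightarrow> F (x - y) = F x - F y"
  and algebra_hom_mult: "algebra_hom F \<Longrightarrow> F (x * y) = F x * F y"
  and algebra_hom_one: "algebra_hom F \<Longrightarrow> F 1 = 1"
  by (simp_all add: algebra_hom_def clinear_scaleC clinear_add clinear_minus clinear_zero)

lemmas algebra_hom_simps = algebra_hom_scaleC algebra_hom_add algebra_hom_zero algebra_hom_diff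
  algebra_hom_mult algebra_hom_one

text \<open>The uniqueness half of the universal property, modulo an ideal.\<close>

lemma algebra_homs_congruent:
  fixes F H :: "'v::complex_vector tensor_algebra \<Rightarrow> 'w::complex_vector tensor_algebra"
  assumes "algebra_hom F" "algebra_hom H"
    and "\<And>v. quot_class S (F (talg_inj v)) = quot_class S (H (talg_inj v))"
  shows "quot_class S (F x) = quot_class S (H x)"
proof (induction x rule: tensor_algebra_induct)
  case (scaleC c t)
  \<comment> \<open>The quotient is only a ring, so a scalar acts as multiplication by the class of
    \<open>c *\<^sub>C 1\<close>.\<close>
  have "quot_class S ((c *\<^sub>C 1) * F t) = quot_class S ((c *\<^sub>C 1) * H t)"
    by (simp only: quot_class_mult scaleC)
  then show ?case using assms by (simp add: algebra_hom_scaleC flip: scaleC_eq_mult)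
qed (use assms in \<open>simp_all add: algebra_hom_simps quot_class_mult quot_class_add\<close>)

text \<open>First isomorphism theorem for \<open>F\<close> followed by the quotient map:
  \<open>FR\<close> puts the ideal of \<open>R\<close> into the kernel, \<open>HS\<close> and
  \<open>HF\<close> give the reverse inclusion by applying \<open>H\<close>, and \<open>FH\<close>
  gives surjectivity.\<close>

lemma quot_algebra_iso:
  fixes F :: "'v::complex_vector tensor_algebra \<Rightarrow> 'w::complex_vector tensor_algebra"
  assumes F: "algebra_hom F" and H: "algebra_hom H"
    and FR: "\<And>x. x \<in> R \<Longrightarrow> quot_class S (F x) = quot_class S 0"
    and HS: "\<And>y. y \<in> S \<Longrightarrow> quot_class R (H y) = quot_class R 0"
    and HF: "\<And>v. quot_class R (H (F (talg_inj v))) = quot_class R (talg_inj v)"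
    and FH: "\<And>w. quot_class S (F (H (talg_inj w))) = quot_class S (talg_inj w)"
  obtains \<phi> where "\<phi> \<in> algebra_iso R S" "\<And>x. \<phi> (quot_class R x) = quot_class S (F x)"
proof -
  have hom: "quot_class Q \<circ> E \<in> ring_hom talg_ring (quot_algebra Q)"
    if "algebra_hom E"
    for E :: "'x::complex_vector tensor_algebra \<Rightarrow> 'y::complex_vector tensor_algebra" and Q
    using that by (intro ring_hom_trans[OF _ quot_class_ring_hom])
      (simp add: ring_hom_def algebra_hom_simps)
  have hom_ring: "ring_hom_ring talg_ring (quot_algebra Q) (quot_class Q \<circ> E)"
    if "algebra_hom E"
    for E :: "'x::complex_vector tensor_algebra \<Rightarrow> 'y::complex_vector tensor_algebra" and Q
    by (rule ring_hom_ringI2[OF ring_talg_ring ring_quot_algebra hom[OF that]])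
  have kernel: "a_kernel talg_ring (quot_algebra Q) (quot_class Q \<circ> E)
      = {x. quot_class Q (E x) = quot_class Q 0}"
    for E :: "'x::complex_vector tensor_algebra \<Rightarrow> 'y::complex_vector tensor_algebra" and Q
    by (simp add: a_kernel_def' quot_class_zero)
  \<comment> \<open>The kernel is an ideal containing \<open>P\<close>, and the generated ideal is
    the least such.\<close>
  have ideal_kernel: "genideal talg_ring P \<subseteq> {x. quot_class Q (E x) = quot_class Q 0}"
    if "algebra_hom E" "\<And>x. x \<in> P \<Longrightarrow> quot_class Q (E x) = quot_class Q 0"
    for E :: "'x::complex_vector tensor_algebra \<Rightarrow> 'y::complex_vector tensor_algebra" and P Q
    unfolding kernel[symmetric]
    by (rule ring.genideal_minimal[OF ring_talg_ring
          ring_hom_ring.kernel_is_ideal[OF hom_ring[OF that(1)]]])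
      (use that(2) in \<open>auto simp: kernel\<close>)
  have HF': "quot_class R (H (F x)) = quot_class R x" for x
    using algebra_homs_congruent[OF algebra_hom_comp[OF H F] algebra_hom_id] HF by simp
  have FH': "quot_class S (F (H y)) = quot_class S y" for y
    using algebra_homs_congruent[OF algebra_hom_comp[OF F H] algebra_hom_id] FH by simp
  have "{x. quot_class S (F x) = quot_class S 0} = genideal talg_ring R"
  proof
    show "{x. quot_class S (F x) = quot_class S 0} \<subseteq> genideal talg_ring R"
    proof clarify
      fix x assume "quot_class S (F x) = quot_class S 0"
      then have "F x \<in> genideal talg_ring S" by (simp add: quot_class_eq_iff)
      then have "quot_class R (H (F x)) = quot_class R 0" using ideal_kernel[OF H HS] by blast
      then show "x \<in> genideal talg_ring R" by (simp add: HF' quot_class_eq_iff)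
    qed
  qed (rule ideal_kernel[OF F FR])
  then have ker: "a_kernel talg_ring (quot_algebra S) (quot_class S \<circ> F) = genideal talg_ring R"
    by (simp only: kernel)
  interpret h: ring_hom_ring talg_ring "quot_algebra S" "quot_class S \<circ> F" by (rule hom_ring[OF F])
  \<comment> \<open>The induced map in the form of \<open>FactRing_iso_set\<close>: the constant
    value of the homomorphism on a coset.\<close>
  define \<phi> where "\<phi> = (\<lambda>Z. the_elem ((quot_class S \<circ> F) ` Z))"
  have \<phi>: "\<phi> (quot_class R x) = quot_class S (F x)" for x
    using h.the_elem_simp[of x] unfolding \<phi>_def ker by (simp add: quot_class_def)
  \<comment> \<open>The class of \<open>y\<close> is attained at \<open>H y\<close>.\<close>
  have "range (quot_class S \<circ> F) = range (quot_class S)"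
    using FH' by (auto simp: image_iff)
  then have "\<phi> \<in> ring_iso (quot_algebra R) (quot_algebra S)"
    using h.FactRing_iso_set unfolding \<phi>_def ker quot_algebra_def[symmetric]
    by (simp add: carrier_quot_algebra)
  then have "\<phi> \<in> algebra_iso R S"
    by (simp add: algebra_iso_def \<phi> algebra_hom_simps[OF F])
  from this \<phi> show thesis by (rule that)
qed

lemma quot_class_relator:
  assumes "x - y \<in> R"
  shows "quot_class R x = quot_class R y"
  using assms ring.genideal_self[OF ring_talg_ring, of R] by (auto simp: quot_class_eq_iff)

section \<open>The enveloping algebra as a quotient of T(V)\<close>

context graded_bracket
begin

text \<open>The relators correspond: \<open>H\<close> sends the \<open>Psi\<close> relator of a pair
  from g to minus the enveloping relator, and those involving a unit to 0. Conversely, the image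
  under \<open>F\<close> of an enveloping relator is a \<open>Psi\<close> relator up to sign once
  \<open>unitV\<close> is identified with 1.\<close>

lemma enveloping_algebra_iso:
  "\<exists>\<phi> \<in> algebra_iso (enveloping_relators G br) (Psi_relators G br).
     \<forall>\<xi>. \<phi> (quot_class (enveloping_relators G br) (talg_inj \<xi>))
       = quot_class (Psi_relators G br) (talg_inj (inV \<xi>))"
proof -
  let ?R = "enveloping_relators G br" and ?S = "Psi_relators G br"
  note inj_lin = clinear_add[OF clinear_talg_inj] clinear_scaleC[OF clinear_talg_inj]
  have "clinear (\<lambda>\<xi>. talg_inj (inV \<xi>))"
    by (rule clinearI) (simp_all only: inV_lin inj_lin)
  from tensor_algebra_universal[OF this] obtain F :: "'g tensor_algebra \<Rightarrow> 'g ext tensor_algebra"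
    where F: "algebra_hom F" and F_inj: "\<And>\<xi>. F (talg_inj \<xi>) = talg_inj (inV \<xi>)" by metis
  have "clinear (\<lambda>v :: 'g ext. fst v *\<^sub>C 1 + talg_inj (snd v))"
    by (rule clinearI) (simp_all add: inj_lin scaleC_prod_def scaleC_complex_def
        scaleC_left_distrib scaleC_right_distrib scaleC_scaleC)
  from tensor_algebra_universal[OF this] obtain H :: "'g ext tensor_algebra \<Rightarrow> 'g tensor_algebra"
    where H: "algebra_hom H" and H_inj: "\<And>v. H (talg_inj v) = fst v *\<^sub>C 1 + talg_inj (snd v)"
    by metis
  have inj0: "talg_inj 0 = 0" by (rule clinear_zero[OF clinear_talg_inj])
  have H_inV: "H (talg_inj (inV \<xi>)) = talg_inj \<xi>" and H_unit: "H (talg_inj unitV) = 1" for \<xi>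
    by (simp_all add: H_inj inj0 scaleC_one)
  have unit: "quot_class ?S (talg_inj unitV) = quot_class ?S 1"
    by (rule quot_class_relator) (simp add: Psi_relators_def)
  have S: "quot_class ?S (talg_mult (Psi G br t)) = quot_class ?S (talg_mult t)" for t
    by (rule quot_class_relator) (auto simp: Psi_relators_def)
  note mult_lin = clinear_add[OF clinear_talg_mult] clinear_scaleC[OF clinear_talg_mult]
  have FR: "quot_class ?S (F x) = quot_class ?S 0" if R: "x \<in> ?R" for x
  proof -
    obtain i j \<xi> \<eta> where x: "x = talg_inj \<xi> * talg_inj \<eta>
        - koszul i j *\<^sub>C (talg_inj \<eta> * talg_inj \<xi>) - talg_inj (br (\<xi> \<otimes>\<^sub>t \<eta>))"
      and hom: "\<xi> \<in> G i" "\<eta> \<in> G j"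
      using R unfolding enveloping_relators_def by blast
    let ?m = "koszul i j *\<^sub>C (talg_inj (inV \<eta>) * talg_inj (inV \<xi>))"
    let ?b = "talg_inj (inV (br (\<xi> \<otimes>\<^sub>t \<eta>)))"
    \<comment> \<open>A factor 1 is inserted and traded for \<open>unitV\<close>, giving the bracket
      term the shape it has in \<open>Psi\<close>.\<close>
    have "quot_class ?S (?m + ?b) = quot_class ?S (?m + ?b * 1)" by simp
    also have "\<dots> = quot_class ?S (?m + ?b * talg_inj unitV)"
      by (simp only: quot_class_add quot_class_mult unit)
    also have "\<dots> = quot_class ?S (talg_inj (inV \<xi>) * talg_inj (inV \<eta>))"
      using S[of "inV \<xi> \<otimes>\<^sub>t inV \<eta>"] by (simp add: Psi_inV_inV[OF hom] mult_lin)
    finally have "?m + ?b - talg_inj (inV \<xi>) * talg_inj (inV \<eta>) \<in> genideal talg_ring ?S"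
      by (simp only: quot_class_eq_iff)
    then have "quot_class ?S 0 = quot_class ?S (F x)"
      by (simp add: quot_class_eq_iff x algebra_hom_simps[OF F] F_inj algebra_simps)
    then show ?thesis by (rule sym)
  qed
  have HS: "quot_class ?R (H y) = quot_class ?R 0" if y: "y \<in> ?S" for y
  proof (cases "y = talg_inj unitV - 1")
    case True
    then show ?thesis by (simp add: algebra_hom_simps[OF H] H_unit)
  next
    case False
    then obtain t where y: "y = talg_mult (Psi G br t) - talg_mult t"
      using y unfolding Psi_relators_def by blast
    \<comment> \<open>Linear in \<open>t\<close>, so vanishing modulo \<open>?R\<close> can be
      tested on tensors of generators.\<close>
    define D where "D t = H (talg_mult (Psi G br t) - talg_mult t)" for t
    have D_add: "D (s + t) = D s + D t" and D_scale: "D (c *\<^sub>C t) = (c *\<^sub>C 1) * D t" for s t c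
      by (simp_all add: D_def Psi_simps mult_lin algebra_hom_simps[OF H]
          mult_scaleC_left complex_vector.scale_right_diff_distrib)
    have D_unit: "D (unitV \<otimes>\<^sub>t unitV) = 0" "D (unitV \<otimes>\<^sub>t inV \<xi>) = 0" "D (inV \<xi> \<otimes>\<^sub>t unitV) = 0" for \<xi>
      by (simp_all add: D_def Psi_simps algebra_hom_simps[OF H] H_inV H_unit)
    have D_hom: "quot_class ?R (D (inV \<xi> \<otimes>\<^sub>t inV \<eta>)) = quot_class ?R 0"
      if "\<xi> \<in> G i" "\<eta> \<in> G j" for i j \<xi> \<eta>
    proof (rule sym, rule quot_class_relator)
      \<comment> \<open>Subtracting from 0 corrects the sign, so the difference is literally a
        relator.\<close>
      have "0 - D (inV \<xi> \<otimes>\<^sub>t inV \<eta>) = talg_inj \<xi> * talg_inj \<eta>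
          - koszul i j *\<^sub>C (talg_inj \<eta> * talg_inj \<xi>) - talg_inj (br (\<xi> \<otimes>\<^sub>t \<eta>))"
        by (simp add: D_def Psi_inV_inV[OF that] mult_lin algebra_hom_simps[OF H] H_inV H_unit)
      then show "0 - D (inV \<xi> \<otimes>\<^sub>t inV \<eta>) \<in> ?R"
        unfolding enveloping_relators_def using that by blast
    qed
    have gens: "quot_class ?R (D (v \<otimes>\<^sub>t w)) = quot_class ?R 0"
      if "v \<in> ext_gens G" "w \<in> ext_gens G" for v w
      using that[THEN ext_gens_cases] by (elim disjE exE conjE) (simp_all add: D_unit D_hom)
    have "t \<in> complex_vector.span {v \<otimes>\<^sub>t w | v w. v \<in> ext_gens G \<and> w \<in> ext_gens G}"
      unfolding span_tens[OF span_ext_gens[OF grading] span_ext_gens[OF grading]] by (rule UNIV_I)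
    then have "quot_class ?R (D t) = quot_class ?R 0"
    proof (induction rule: complex_vector.span_induct_alt)
      case base
      show ?case using D_scale[of 0 0] by simp
    next
      case (step c s t)
      then have "quot_class ?R (D s) = quot_class ?R 0" using gens by blast
      then have "quot_class ?R (D (c *\<^sub>C s + t)) = quot_class ?R ((c *\<^sub>C 1) * 0 + 0)"
        by (simp only: D_add D_scale quot_class_add quot_class_mult step)
      then show ?case by simp
    qed
    then show ?thesis by (simp add: y D_def)
  qed
  have HF: "quot_class ?R (H (F (talg_inj v))) = quot_class ?R (talg_inj v)" for v
    by (simp add: F_inj H_inV)
  have FH: "quot_class ?S (F (H (talg_inj w))) = quot_class ?S (talg_inj w)" for w
  proof -
    \<comment> \<open>\<open>F\<close> after \<open>H\<close> sends \<open>unitV\<close> to 1, hence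
      fixes generators only modulo the relator \<open>talg_inj unitV - 1\<close>.\<close>
    have "w = fst w *\<^sub>C unitV + inV (snd w)"
      by (simp add: prod_eq_iff scaleC_prod_def scaleC_complex_def)
    then have "talg_inj w = (fst w *\<^sub>C 1) * talg_inj unitV + talg_inj (inV (snd w))"
      by (metis inj_lin scaleC_eq_mult)
    then have "quot_class ?S (talg_inj w)
        = quot_class ?S ((fst w *\<^sub>C 1) * 1 + talg_inj (inV (snd w)))"
      by (simp only: quot_class_add quot_class_mult unit)
    then show ?thesis by (simp add: H_inj algebra_hom_simps[OF F] F_inj)
  qed
  obtain \<phi> where "\<phi> \<in> algebra_iso ?R ?S" "\<And>x. \<phi> (quot_class ?R x) = quot_class ?S (F x)"
    using quot_algebra_iso[OF F H] FR HS HF FH by metis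
  then show ?thesis by (intro bexI[of _ \<phi>] allI) (simp_all only: F_inj)
qed

end

theorem mainTheorem4:
  fixes G :: "bit \<Rightarrow> 'g::complex_vector set"
    and br :: "('g, 'g) tensor \<Rightarrow> 'g"
  assumes "Z2_grading G"
    and "clinear br"
    and "degree_preserving (tensor_grading G) G br"
  shows "(braid_relation (Psi G br) \<longleftrightarrow> super_Jacobi G br)
    \<and> ((\<lambda>t. Psi G br (Psi G br t) - t) \<circ> (\<lambda>t. Psi G br t + t) = (\<lambda>t. 0)
         \<longleftrightarrow> graded_antisymmetric G br)
    \<and> (super_Lie_algebra G br \<longrightarrow>
         (\<exists>\<phi> \<in> algebra_iso (enveloping_relators G br) (Psi_relators G br).
            \<forall>\<xi>. \<phi> (quot_class (enveloping_relators G br) (talg_inj \<xi>))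
                  = quot_class (Psi_relators G br) (talg_inj (inV \<xi>))))"
proof -
  interpret graded_bracket G br by (rule graded_bracket.intro[OF assms(1,2)])
  show ?thesis
    using braid_relation_iff[OF assms(3)] graded_antisymmetric_iff enveloping_algebra_iso by blast
qed

end
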